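(* Suppose $\kappa = \cos(\alpha) > 0$. Then for every $g \in SU_2$ the infimum of the cost of admissible decompositions of $g$ is attained on a reduced $n$-optimal word $$g = \exp(t_1 C_1)\exp(t_2 C_2)\cdots\exp(t_n C_n)$$ (for some $n \ge 0$) which satisfies the $\pi$-condition, satisfies $t_p = t_{p+2}$ for all $2 \le p \le n-3$, whose middle time parameters corresponding to $Y$ satisfy $\frac{\pi}{2} \le t_y < \pi$, and which, when $n \ge 4$, satisfies $t_x = \frac{\pi}{2}$.
   Context: Setting. $SU_2$ is realized as the group of unit quaternions, and its Lie algebra $su_2$ as the space of purely imaginary quaternions with orthonormal basis $i,j,k$. $X, Y \in su_2$ have norm $1$, and $\alpha \in (0,\pi)$ is the angle between them (e.g. $X = i$, $Y = i\cos\alpha + j\sin\alpha$). The set of controls is $S = \{X,Y\}$. The cost factor of $X$ is $1$ and the cost factor of $Y$ is $\kappa$, where $0 \le \kappa \le 1$. An admissible word of length $n \ge 0$ is an expression $\exp(t_1 C_1)\cdots\exp(t_n C_n)$ with $t_i \ge 0$, $C_i \in S$ (for $n=0$ it is the identity). Its cost is $\sum_i \kappa_i t_i$, with $\kappa_i = 1$ if $C_i = X$ and $\kappa_i = \kappa$ if $C_i = Y$. It is reduced if all $t_i > 0$ and $C_i \ne C_{i+1}$ for all $i$. It is $n$-optimal if it has minimum cost among all admissible words of length $n$ equal to the same element of $SU_2$. The infimum of the cost for $g$ is taken over all admissible words of all lengths equal to $g$. The middle time parameters are the $t_i$ with $2 \le i \le n-1$. Here $t_x$ (resp. $t_y$)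 denotes the common value of the middle time parameters corresponding to $X$ (resp. $Y$); conditions on $t_x$ or $t_y$ are imposed only if a corresponding middle parameter exists. $\pi$-condition: at most one time parameter is $\ge \pi$, and if there is such a parameter, it corresponds to the generator $Y$ and is not a middle time parameter. *)

theory Defs
  imports "HOL-Analysis.Analysis"
begin

text \<open>
  The quaternions as a Euclidean space and a real normed algebra, so that the
  generic norm, inner product and exponential of the library apply to them.
\<close>

datatype quat = Quat (qRe: real) (qIm1: real) (qIm2: real) (qIm3: real)

lemma quat_eq_iff:
  "p = q \<longleftrightarrow> qRe p = qRe q \<and> qIm1 p = qIm1 q \<and> qIm2 p = qIm2 q \<and> qIm3 p = qIm3 q"
  by (cases p; cases q) auto

instantiation quat :: real_algebra_1
begin

definition "0 = Quat 0 0 0 0"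
definition "1 = Quat 1 0 0 0"
definition "p + q = Quat (qRe p + qRe q) (qIm1 p + qIm1 q) (qIm2 p + qIm2 q) (qIm3 p + qIm3 q)"
definition "- p = Quat (- qRe p) (- qIm1 p) (- qIm2 p) (- qIm3 p)"
definition "p - q = Quat (qRe p - qRe q) (qIm1 p - qIm1 q) (qIm2 p - qIm2 q) (qIm3 p - qIm3 q)"
definition "r *\<^sub>R p = Quat (r * qRe p) (r * qIm1 p) (r * qIm2 p) (r * qIm3 p)"
definition "p * q = Quat
  (qRe p * qRe q - qIm1 p * qIm1 q - qIm2 p * qIm2 q - qIm3 p * qIm3 q)
  (qRe p * qIm1 q + qIm1 p * qRe q + qIm2 p * qIm3 q - qIm3 p * qIm2 q)
  (qRe p * qIm2 q - qIm1 p * qIm3 q + qIm2 p * qRe q + qIm3 p * qIm1 q)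
  (qRe p * qIm3 q + qIm1 p * qIm2 q - qIm2 p * qIm1 q + qIm3 p * qRe q)"

lemmas quat_arith_defs =
  zero_quat_def one_quat_def plus_quat_def uminus_quat_def minus_quat_def
  scaleR_quat_def times_quat_def

instance
  by standard (simp_all add: quat_eq_iff quat_arith_defs algebra_simps)

end

instantiation quat :: real_inner
begin

definition "inner p q = qRe p * qRe q + qIm1 p * qIm1 q + qIm2 p * qIm2 q + qIm3 p * qIm3 q"
definition "norm (p::quat) = sqrt (inner p p)"
definition "sgn (p::quat) = p /\<^sub>R norm p"
definition "dist (p::quat) q = norm (p - q)"
definition "(uniformity :: (quat \<times> quat) filter)
  = (INF e\<in>{0 <..}. principal {(x, y). dist x y < e})"
definition "open (U::quat set) \<longleftrightarrow>
  (\<forall>x\<in>U. eventually (\<lambda>(x', y). x' = x \<longrightarrow> y \<in> U) uniformity)"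

instance
proof
  fix p :: quat
  show "inner p p = 0 \<longleftrightarrow> p = 0"
  proof
    assume "inner p p = 0"
    moreover have "0 \<le> qRe p * qRe p" "0 \<le> qIm1 p * qIm1 p"
      "0 \<le> qIm2 p * qIm2 p" "0 \<le> qIm3 p * qIm3 p" by simp_all
    ultimately have "qRe p * qRe p = 0" "qIm1 p * qIm1 p = 0"
      "qIm2 p * qIm2 p = 0" "qIm3 p * qIm3 p = 0"
      unfolding inner_quat_def by linarith+
    then show "p = 0" by (simp add: quat_eq_iff quat_arith_defs)
  qed (simp add: inner_quat_def quat_arith_defs)
  fix q r :: quat and a :: real
  show "inner p q = inner q p"
    by (simp add: inner_quat_def mult.commute)
  show "inner (p + q) r = inner p r + inner q r"
    by (simp add: inner_quat_def plus_quat_def algebra_simps)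
  show "inner (a *\<^sub>R p) q = a * inner p q"
    by (simp add: inner_quat_def scaleR_quat_def algebra_simps)
  show "0 \<le> inner p p"
    by (simp add: inner_quat_def)
qed (rule norm_quat_def sgn_quat_def dist_quat_def uniformity_quat_def open_quat_def)+

end

lemma norm_mult_quat: "norm (p * q) = norm p * norm (q::quat)"
proof -
  have "inner (p * q) (p * q) = inner p p * inner q q"
    by (cases p; cases q) (simp add: inner_quat_def times_quat_def algebra_simps)
  then show ?thesis
    by (simp only: norm_quat_def real_sqrt_mult)
qed

instance quat :: real_normed_algebra_1
proof
  fix p q :: quat
  show "norm (p * q) \<le> norm p * norm q"
    by (rule eq_refl) (rule norm_mult_quat)
  show "norm (1::quat) = 1"
    unfolding norm_quat_def inner_quat_def one_quat_def by simp
qed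

instantiation quat :: euclidean_space
begin

definition "Basis = {Quat 1 0 0 0, Quat 0 1 0 0, Quat 0 0 1 0, Quat 0 0 0 1}"

instance
proof
  show "Basis \<noteq> ({} :: quat set)" and "finite (Basis :: quat set)"
    unfolding Basis_quat_def by simp_all
next
  fix u v :: quat
  assume "u \<in> Basis" "v \<in> Basis"
  then show "inner u v = (if u = v then 1 else 0)"
    unfolding Basis_quat_def insert_iff empty_iff
    by (elim disjE FalseE) (simp_all add: inner_quat_def)
next
  fix p :: quat
  have "(\<forall>u\<in>Basis. inner p u = 0) \<longleftrightarrow> qRe p = 0 \<and> qIm1 p = 0 \<and> qIm2 p = 0 \<and> qIm3 p = 0"
    unfolding Basis_quat_def inner_quat_def by simp
  also have "\<dots> \<longleftrightarrow> p = 0"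
    unfolding quat_eq_iff zero_quat_def quat.sel by (rule refl)
  finally show "(\<forall>u\<in>Basis. inner p u = 0) \<longleftrightarrow> p = 0" .
qed

end

instance quat :: banach ..

definition SU2 :: "quat set" where
  "SU2 = {q. norm q = 1}"

definition su2 :: "quat set" where
  "su2 = {q. qRe q = 0}"

definition vec_angle :: "'a::real_inner \<Rightarrow> 'a \<Rightarrow> real" where
  "vec_angle u v = arccos (u \<bullet> v / (norm u * norm v))"

text \<open>
  The word \<open>exp(t\<^sub>1 C\<^sub>1) \<cdots> exp(t\<^sub>n C\<^sub>n)\<close> is the list
  \<open>[(t\<^sub>1, C\<^sub>1), \<dots>, (t\<^sub>n, C\<^sub>n)]\<close>.  Its letters are numbered from \<open>1\<close>:
  \<open>time w i\<close> and \<open>control w i\<close> are meaningful for \<open>1 \<le> i \<le> length w\<close> only.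
\<close>

type_synonym word = "(real \<times> quat) list"

definition time :: "word \<Rightarrow> nat \<Rightarrow> real" where
  "time w i = fst (w ! (i - 1))"

definition control :: "word \<Rightarrow> nat \<Rightarrow> quat" where
  "control w i = snd (w ! (i - 1))"

definition word_val :: "word \<Rightarrow> quat" where
  "word_val w = prod_list (map (\<lambda>(t, C). exp (t *\<^sub>R C)) w)"

definition admissible :: "quat set \<Rightarrow> word \<Rightarrow> bool" where
  "admissible S w \<longleftrightarrow> (\<forall>(t, C) \<in> set w. 0 \<le> t \<and> C \<in> S)"

text \<open>
  The cost factor is \<open>1\<close> for the control \<open>X\<close> and \<open>\<kappa>\<close> for the other control.
\<close>

definition cost :: "quat \<Rightarrow> real \<Rightarrow> word \<Rightarrow> real" where
  "cost X \<kappa> w = sum_list (map (\<lambda>(t, C). (if C = X then 1 else \<kappa>) * t) w)"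

definition reduced_word :: "word \<Rightarrow> bool" where
  "reduced_word w \<longleftrightarrow> (\<forall>i\<in>{1..length w}. 0 < time w i) \<and>
     (\<forall>i. 1 \<le> i \<and> i + 1 \<le> length w \<longrightarrow> control w i \<noteq> control w (i + 1))"

definition n_optimal :: "quat \<Rightarrow> quat \<Rightarrow> real \<Rightarrow> nat \<Rightarrow> word \<Rightarrow> bool" where
  "n_optimal X Y \<kappa> n w \<longleftrightarrow> admissible {X, Y} w \<and> length w = n \<and>
     (\<forall>w'. admissible {X, Y} w' \<and> length w' = n \<and> word_val w' = word_val w
        \<longrightarrow> cost X \<kappa> w \<le> cost X \<kappa> w')"

definition middle :: "word \<Rightarrow> nat \<Rightarrow> bool" where
  "middle w i \<longleftrightarrow> 2 \<le> i \<and> i + 1 \<le> length w"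

definition pi_condition :: "quat \<Rightarrow> word \<Rightarrow> bool" where
  "pi_condition Y w \<longleftrightarrow>
     (\<forall>i\<in>{1..length w}. \<forall>j\<in>{1..length w}. pi \<le> time w i \<and> pi \<le> time w j \<longrightarrow> i = j) \<and>
     (\<forall>i\<in>{1..length w}. pi \<le> time w i \<longrightarrow> control w i = Y \<and> \<not> middle w i)"

text \<open>
  The infimum is taken over words of all lengths.  It is a genuine infimum in
  \<open>\<real>\<close> whenever \<open>0 \<le> \<kappa>\<close> and \<open>g\<close> is the value of some admissible word.
\<close>

definition inf_cost :: "quat \<Rightarrow> quat \<Rightarrow> real \<Rightarrow> quat \<Rightarrow> real" where
  "inf_cost X Y \<kappa> g = Inf {cost X \<kappa> w |w. admissible {X, Y} w \<and> word_val w = g}"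

end

theory Submission
  imports Defs
begin

text \<open>
  At a word of minimal cost among words of the same length, the partial derivatives of value and cost
  with respect to the letters are linearly dependent. For \<open>\<kappa> = cos \<alpha>\<close> this forces
  \<open>sin(2t) = 0\<close> for the middle times of \<open>X\<close> (in words with at least four letters) and the equality
  modulo \<open>\<pi>\<close> of consecutive middle times of \<open>Y\<close>. Hence every middle letter \<open>X\<close> costs at least \<open>\<pi>/2\<close>;
  as all elements of \<open>SU2\<close> are reached with uniformly bounded cost, only words of bounded length
  compete, and compactness yields a word of globally minimal cost. Such a word admits no letter
  \<open>X\<close> of time \<open>\<ge> \<pi>\<close> and at most one letter \<open>Y\<close> of time \<open>\<ge> \<pi>\<close>, because
  \<open>exp(\<pi>X) = exp(\<pi>Y) = -1\<close> is central and \<open>Y\<close> is cheaper. Finally, a middle letter \<open>Y\<close> of time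
  below \<open>\<pi>/2\<close> is never optimal, since a part of \<open>XYX\<close> can be replaced by a cheaper word \<open>YXY\<close>.
\<close>

section \<open>Exponentials of imaginary units and an open mapping argument\<close>

text \<open>The product of \<open>exp(-tq)\<close> with the claimed value is constant: its
  derivative vanishes because \<open>q * q = -1\<close>, and it equals 1 at 0.\<close>

lemma exp_imaginary_unit:
  fixes q :: "'a :: {real_normed_algebra_1, banach}"
  assumes "q * q = -1"
  shows "exp (t *\<^sub>R q) = cos t *\<^sub>R 1 + sin t *\<^sub>R q"
proof -
  define f where "f t = exp (t *\<^sub>R (-q)) * (cos t *\<^sub>R 1 + sin t *\<^sub>R q)" for t
  have "(f has_vector_derivative 0) (at t)" for t
  proof -
    have "(f has_vector_derivative
        exp (t *\<^sub>R (-q)) * ((- sin t) *\<^sub>R 1 + cos t *\<^sub>R q)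
        + exp (t *\<^sub>R (-q)) * (-q) * (cos t *\<^sub>R 1 + sin t *\<^sub>R q)) (at t)"
      unfolding f_def
      by (rule has_vector_derivative_mult exp_scaleR_has_vector_derivative_right)+
         (auto intro!: derivative_eq_intros simp: has_real_derivative_iff_has_vector_derivative[symmetric])
    also have "exp (t *\<^sub>R (-q)) * ((- sin t) *\<^sub>R 1 + cos t *\<^sub>R q)
        + exp (t *\<^sub>R (-q)) * (-q) * (cos t *\<^sub>R 1 + sin t *\<^sub>R q) = 0"
      by (simp add: algebra_simps assms mult.assoc)
    finally show ?thesis .
  qed
  then have "f t = f 0"
    by (metis has_vector_derivative_zero_constant[of UNIV f] UNIV_I convex_UNIV)
  then have *: "exp (-(t *\<^sub>R q)) * (cos t *\<^sub>R 1 + sin t *\<^sub>R q) = 1"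
    by (simp add: f_def)
  have "exp (t *\<^sub>R q) = exp (t *\<^sub>R q) * (exp (-(t *\<^sub>R q)) * (cos t *\<^sub>R 1 + sin t *\<^sub>R q))"
    by (simp only: * mult_1_right)
  also have "\<dots> = cos t *\<^sub>R 1 + sin t *\<^sub>R q"
    by (simp only: mult.assoc[symmetric] exp_minus_inverse mult_1_left)
  finally show ?thesis .
qed

lemma quat_sel_arith:
  "qRe 0 = 0" "qIm1 0 = 0" "qIm2 0 = 0" "qIm3 0 = 0"
  "qRe 1 = 1" "qIm1 1 = 0" "qIm2 1 = 0" "qIm3 1 = 0"
  "qRe (p + q) = qRe p + qRe q" "qIm1 (p + q) = qIm1 p + qIm1 q"
  "qIm2 (p + q) = qIm2 p + qIm2 q" "qIm3 (p + q) = qIm3 p + qIm3 q"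
  "qRe (- p) = - qRe p" "qIm1 (- p) = - qIm1 p" "qIm2 (- p) = - qIm2 p" "qIm3 (- p) = - qIm3 p"
  "qRe (p - q) = qRe p - qRe q" "qIm1 (p - q) = qIm1 p - qIm1 q"
  "qIm2 (p - q) = qIm2 p - qIm2 q" "qIm3 (p - q) = qIm3 p - qIm3 q"
  "qRe (r *\<^sub>R p) = r * qRe p" "qIm1 (r *\<^sub>R p) = r * qIm1 p"
  "qIm2 (r *\<^sub>R p) = r * qIm2 p" "qIm3 (r *\<^sub>R p) = r * qIm3 p"
  "qRe (p * q) = qRe p * qRe q - qIm1 p * qIm1 q - qIm2 p * qIm2 q - qIm3 p * qIm3 q"
  "qIm1 (p * q) = qRe p * qIm1 q + qIm1 p * qRe q + qIm2 p * qIm3 q - qIm3 p * qIm2 q"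
  "qIm2 (p * q) = qRe p * qIm2 q - qIm1 p * qIm3 q + qIm2 p * qRe q + qIm3 p * qIm1 q"
  "qIm3 (p * q) = qRe p * qIm3 q + qIm1 p * qIm2 q - qIm2 p * qIm1 q + qIm3 p * qRe q"
  by (simp_all add: quat_arith_defs)

lemma norm_Quat: "norm (Quat a b d e) = sqrt (a * a + b * b + d * d + e * e)"
  by (simp add: norm_quat_def inner_quat_def)

text \<open>The derivative is invertible, so \<open>F\<close> is open at \<open>x\<close>, and
  points slightly closer to 0 than \<open>F x\<close> on the same ray are still values. For a map
  whose norm encodes cost, this turns a nondegenerate derivative into a cheaper word.\<close>

lemma inj_derivative_scaled_value:
  fixes F :: "'a::euclidean_space \<Rightarrow> 'b::euclidean_space"
  assumes dim: "DIM('a) = DIM('b)" and cont: "continuous_on UNIV F"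
    and deriv: "(F has_derivative F') (at x)" and inj: "\<And>h. F' h = 0 \<Longrightarrow> h = 0"
    and T: "open T" "x \<in> T"
  shows "\<exists>y\<in>T. \<exists>r. 0 < r \<and> r < 1 \<and> F y = r *\<^sub>R F x"
proof -
  have lin: "linear F'"
    using deriv has_derivative_linear by blast
  have "inj F'"
    using linear_injective_0[OF lin] inj by blast
  then obtain g' where g': "linear g'" "\<forall>x. F' (g' x) = x"
    using linear_injective_isomorphism[OF lin] dim by (auto simp: dim_UNIV)
  have "F x \<in> interior (F ` T)"
    by (rule sussmann_open_mapping[OF open_UNIV cont UNIV_I deriv linear_conv_bounded_linear[THEN iffD1, OF g'(1)]])
      (use g' T in \<open>auto simp: fun_eq_iff interior_open\<close>)
  then obtain e where e: "e > 0" "ball (F x) e \<subseteq> F ` T"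
    unfolding mem_interior by blast
  \<comment> \<open>The move from \<open>F x\<close> towards 0 has length
    \<open>d * norm (F x)\<close> and must stay below \<open>e\<close>; the summand 1 covers the
    case \<open>F x = 0\<close>.\<close>
  define d where "d = min (1/2) (e / (2 * (norm (F x) + 1)))"
  have "d \<le> 1/2"
    unfolding d_def by (rule min.cobounded1)
  moreover have "0 < d"
    using e by (simp add: d_def add_nonneg_pos)
  ultimately have d: "0 < d" "d \<le> 1/2"
    by simp_all
  have "d * norm (F x) \<le> d * (norm (F x) + 1)"
    using d by (intro mult_left_mono) auto
  also have "\<dots> \<le> e / (2 * (norm (F x) + 1)) * (norm (F x) + 1)"
    by (rule mult_right_mono) (auto simp: d_def)
  also have "\<dots> = e / 2"
    using norm_ge_zero[of "F x"] by (simp add: field_simps add_nonneg_eq_0_iff)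
  finally have "d * norm (F x) < e"
    using e by simp
  then have "(1 - d) *\<^sub>R F x \<in> ball (F x) e"
    using d by (simp add: dist_norm algebra_simps)
  then obtain y where "y \<in> T" "F y = (1 - d) *\<^sub>R F x"
    using e by (metis imageE subsetD)
  then show ?thesis
    using d by (intro bexI[of _ y] exI[of _ "1 - d"]) auto
qed

section \<open>Words, their windows and list positions\<close>

lemma word_val_simps [simp]:
  "word_val [] = 1" "word_val ((t, C) # w) = exp (t *\<^sub>R C) * word_val w"
  "word_val (u @ v) = word_val u * word_val v"
  by (simp_all add: word_val_def)

lemma admissible_simps [simp]:
  "admissible S []" "admissible S ((t, C) # w) \<longleftrightarrow> 0 \<le> t \<and> C \<in> S \<and> admissible S w"
  "admissible S (u @ v) \<longleftrightarrow> admissible S u \<and> admissible S v"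
  by (auto simp: admissible_def)

lemma cost_simps [simp]:
  "cost X k [] = 0" "cost X k ((t, C) # w) = (if C = X then 1 else k) * t + cost X k w"
  "cost X k (u @ v) = cost X k u + cost X k v"
  by (simp_all add: cost_def)

text \<open>A cheaper word of the same length and value could be substituted for \<open>v\<close>
  inside the long word. Hence first-order conditions need only be derived for windows of four or
  five letters.\<close>

lemma n_optimal_window:
  assumes "n_optimal X Y k n (u @ v @ r)"
  shows "n_optimal X Y k (length v) v"
  unfolding n_optimal_def
proof (intro conjI allI impI)
  fix v' assume v': "admissible {X, Y} v' \<and> length v' = length v \<and> word_val v' = word_val v"
  then have "cost X k (u @ v @ r) \<le> cost X k (u @ v' @ r)"
    using assms unfolding n_optimal_def by (metis admissible_simps(3) length_append word_val_simps(3))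
  then show "cost X k v \<le> cost X k v'"
    by simp
qed (use assms in \<open>auto simp: n_optimal_def\<close>)

lemma polar_arctan:
  fixes a b :: real
  assumes "a > 0"
  shows "a = sqrt (a\<^sup>2 + b\<^sup>2) * cos (arctan (b / a))" "b = sqrt (a\<^sup>2 + b\<^sup>2) * sin (arctan (b / a))"
proof -
  have "1 + (b / a)\<^sup>2 = (a\<^sup>2 + b\<^sup>2) / a\<^sup>2"
    using assms by (simp add: field_simps)
  then have "sqrt (1 + (b / a)\<^sup>2) = sqrt (a\<^sup>2 + b\<^sup>2) / a"
    using assms by (simp add: real_sqrt_divide)
  moreover have "sqrt (a\<^sup>2 + b\<^sup>2) \<noteq> 0"
    using assms by (simp add: sum_power2_eq_zero_iff)
  ultimately show "a = sqrt (a\<^sup>2 + b\<^sup>2) * cos (arctan (b / a))" "b = sqrt (a\<^sup>2 + b\<^sup>2) * sin (arctan (b / a))"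
    using assms by (simp_all add: cos_arctan sin_arctan)
qed

lemma decompose_nth1:
  assumes "i < length w"
  shows "w = take i w @ w ! i # drop (i + 1) w"
  using id_take_nth_drop[OF assms] by simp

lemma decompose_nth2:
  assumes "i + 1 < length w"
  shows "w = take i w @ w ! i # w ! (i + 1) # drop (i + 2) w"
  using assms Cons_nth_drop_Suc[of i w] Cons_nth_drop_Suc[of "i + 1" w] append_take_drop_id[of i w] by simp

lemma decompose_nth3:
  assumes "i + 2 < length w"
  shows "w = take i w @ w ! i # w ! (i + 1) # w ! (i + 2) # drop (i + 3) w"
  using assms decompose_nth2[of i w] Cons_nth_drop_Suc[of "i + 2" w] by (simp add: numeral_3_eq_3)

lemma decompose_nth4:
  assumes "i + 3 < length w"
  shows "w = take i w @ [w ! i, w ! (i + 1), w ! (i + 2), w ! (i + 3)] @ drop (i + 4) w"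
  using assms decompose_nth3[of i w] Cons_nth_drop_Suc[of "i + 3" w] by (simp add: eval_nat_numeral)

lemma decompose_nth5:
  assumes "i + 4 < length w"
  shows "w = take i w @ [w ! i, w ! (i + 1), w ! (i + 2), w ! (i + 3), w ! (i + 4)] @ drop (i + 5) w"
  using assms decompose_nth4[of i w] Cons_nth_drop_Suc[of "i + 4" w] by (simp add: eval_nat_numeral)

text \<open>The definitions number letters from 1; the proof uses list positions from 0, where the
  middle letters are those with \<open>1 \<le> i\<close> and
  \<open>i + 1 < length w\<close>.\<close>

lemma reduced_word_nth:
  "reduced_word w \<longleftrightarrow> (\<forall>i<length w. 0 < fst (w ! i)) \<and> (\<forall>i. i + 1 < length w \<longrightarrow> snd (w ! i) \<noteq> snd (w ! (i + 1)))"
proof -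
  have "(\<forall>i\<in>{1..length w}. 0 < time w i) \<longleftrightarrow> (\<forall>i<length w. 0 < fst (w ! i))"
  proof (intro iffI allI ballI impI)
    fix i assume "\<forall>i\<in>{1..length w}. 0 < time w i" "i < length w"
    then show "0 < fst (w ! i)"
      by (auto simp: time_def dest: bspec[of _ _ "i + 1"])
  next
    fix i assume "\<forall>i<length w. 0 < fst (w ! i)" "i \<in> {1..length w}"
    then show "0 < time w i"
      by (auto simp: time_def dest: spec[of _ "i - 1"])
  qed
  moreover have "(\<forall>i. 1 \<le> i \<and> i + 1 \<le> length w \<longrightarrow> control w i \<noteq> control w (i + 1)) \<longleftrightarrow>
      (\<forall>i. i + 1 < length w \<longrightarrow> snd (w ! i) \<noteq> snd (w ! (i + 1)))"
  proof (intro iffI allI impI)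
    fix i assume "\<forall>i. 1 \<le> i \<and> i + 1 \<le> length w \<longrightarrow> control w i \<noteq> control w (i + 1)" "i + 1 < length w"
    then show "snd (w ! i) \<noteq> snd (w ! (i + 1))"
      by (auto simp: control_def dest: spec[of _ "i + 1"])
  next
    fix i assume "\<forall>i. i + 1 < length w \<longrightarrow> snd (w ! i) \<noteq> snd (w ! (i + 1))" "1 \<le> i \<and> i + 1 \<le> length w"
    then show "control w i \<noteq> control w (i + 1)"
      by (auto simp: control_def dest: spec[of _ "i - 1"])
  qed
  ultimately show ?thesis
    by (simp add: reduced_word_def)
qed

text \<open>The list is cut into disjoint consecutive pairs. This suits alternating words, where
  every pair contains a letter \<open>X\<close> of cost bounded below.\<close>

lemma sum_list_pairs_ge:
  fixes xs :: "real list"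
  assumes "\<And>i. i + 1 < length xs \<Longrightarrow> q \<le> xs ! i + xs ! (i + 1)" "\<forall>x\<in>set xs. 0 \<le> x"
  shows "q * real (length xs div 2) \<le> sum_list xs"
  using assms
proof (induction xs rule: induct_list012)
  case (3 x y zs)
  have "q * real (length zs div 2) \<le> sum_list zs"
    using 3(3)[of "_ + 2"] 3(4) by (intro 3(1)) auto
  moreover have "q \<le> x + y"
    using 3(3)[of 0] by simp
  ultimately show ?case
    by (simp add: algebra_simps)
qed auto

lemma pi_half_le_of_sin_double_eq_0:
  assumes "0 < b" "sin (2 * b) = 0"
  shows "pi / 2 \<le> b"
  using assms sin_gt_zero[of "2 * b"] by (cases "b < pi / 2") auto

lemma reduced_word_iff: "reduced_word w \<longleftrightarrow> (\<forall>l\<in>set w. 0 < fst l) \<and> distinct_adj (map snd w)"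
  by (auto simp: reduced_word_nth distinct_adj_conv_nth all_set_conv_all_nth)

lemma eq_pi_half_of_sin_double_eq_0:
  assumes "0 < b" "b < pi" "sin (2 * b) = 0"
  shows "b = pi / 2"
proof -
  have "sin b * cos b = 0"
    using assms(3) by (simp add: sin_double)
  then have "cos b = cos (pi / 2)"
    using sin_gt_zero[OF assms(1,2)] by simp
  then show ?thesis
    using cos_inj_pi[of b "pi / 2"] assms(1,2) by simp
qed

section \<open>Coordinates adapted to the controls\<close>

locale two_controls =
  fixes X Y :: quat and \<kappa> :: real
  assumes X_su2: "X \<in> su2" and Y_su2: "Y \<in> su2"
    and norm_X: "norm X = 1" and norm_Y: "norm Y = 1"
    and inner_XY: "X \<bullet> Y = \<kappa>" and \<kappa>_pos: "0 < \<kappa>" and \<kappa>_less_1: "\<kappa> < 1"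
begin

text \<open>The length of the component of \<open>Y\<close> orthogonal to \<open>X\<close>, that is,
  sin \<alpha>.\<close>

definition s where "s = sqrt (1 - \<kappa>\<^sup>2)"

lemma s_pos: "s > 0"
  using \<kappa>_pos \<kappa>_less_1 by (simp add: s_def power_less_one_iff abs_square_less_1)

lemma s_sq: "s * s = 1 - \<kappa> * \<kappa>"
  using s_pos by (simp add: s_def power2_eq_square[symmetric])

definition Z where "Z = (1 / s) *\<^sub>R (Y - \<kappa> *\<^sub>R X)"

lemma Y_eq: "Y = \<kappa> *\<^sub>R X + s *\<^sub>R Z"
  using s_pos by (simp add: Z_def)

lemma Z_su2: "Z \<in> su2"
  using X_su2 Y_su2 by (simp add: Z_def su2_def quat_arith_defs)

lemma inner_XX: "X \<bullet> X = 1" and inner_YY: "Y \<bullet> Y = 1"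
  using norm_X norm_Y by (simp_all add: norm_eq_1)

lemma inner_XZ: "X \<bullet> Z = 0"
  by (simp add: Z_def inner_XX inner_XY algebra_simps)

lemma inner_ZZ: "Z \<bullet> Z = 1"
proof -
  have "Y \<bullet> Y = \<kappa> * \<kappa> + s * s * (Z \<bullet> Z)"
    by (subst (1 2) Y_eq)
      (simp add: inner_add_left inner_add_right inner_XX inner_XZ inner_commute[of Z X])
  then have "s * s * (Z \<bullet> Z - 1) = 0"
    unfolding right_diff_distrib using inner_YY s_sq by linarith
  then show ?thesis
    using s_pos by simp
qed

lemma su2_mult_self: "p \<in> su2 \<Longrightarrow> p * p = - (p \<bullet> p) *\<^sub>R 1"
  by (simp add: su2_def quat_eq_iff quat_arith_defs inner_quat_def)

lemma su2_anticommute: "p \<in> su2 \<Longrightarrow> q \<in> su2 \<Longrightarrow> p \<bullet> q = 0 \<Longrightarrow> q * p = - (p * q)"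
  by (simp add: su2_def quat_eq_iff quat_arith_defs inner_quat_def algebra_simps)

lemma XX: "X * X = -1" and YY: "Y * Y = -1" and ZZ: "Z * Z = -1" and ZX: "Z * X = - (X * Z)"
  using su2_mult_self[OF X_su2] su2_mult_self[OF Y_su2] su2_mult_self[OF Z_su2]
    su2_anticommute[OF X_su2 Z_su2 inner_XZ]
  by (simp_all add: inner_XX inner_YY inner_ZZ)

lemma XX': "X * (X * q) = - q" and ZZ': "Z * (Z * q) = - q" and ZX': "Z * (X * q) = - (X * (Z * q))"
  by (simp_all add: mult.assoc[symmetric] XX ZZ ZX)

text \<open>\<open>1, X, Z, XZ\<close> multiply like \<open>1, i, j, k\<close>, so \<open>emb\<close> is the automorphism carrying
  the normal form \<open>i, \<kappa>i + sj\<close> of the controls to \<open>X, Y\<close>.\<close>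

definition emb :: "quat \<Rightarrow> quat" where
  "emb q = qRe q *\<^sub>R 1 + qIm1 q *\<^sub>R X + qIm2 q *\<^sub>R Z + qIm3 q *\<^sub>R (X * Z)"

lemma emb_mult: "emb (p * q) = emb p * emb q"
  by (simp add: emb_def quat_sel_arith algebra_simps XX ZZ ZX XX' ZZ' ZX')

lemma emb_add: "emb (p + q) = emb p + emb q"
  and emb_scale: "emb (r *\<^sub>R p) = r *\<^sub>R emb p"
  and emb_1: "emb 1 = 1"
  and emb_0: "emb 0 = 0"
  by (simp_all add: emb_def quat_sel_arith algebra_simps)

lemma emb_inner: "emb p \<bullet> emb q = p \<bullet> q"
proof -
  have re: "qRe X = 0" "qRe Z = 0"
    using X_su2 Z_su2 by (simp_all add: su2_def)
  have "(1::quat) \<bullet> 1 = 1" "1 \<bullet> X = 0" "1 \<bullet> Z = 0" "1 \<bullet> (X * Z) = 0"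
    "X \<bullet> (X * Z) = 0" "Z \<bullet> (X * Z) = 0"
    using inner_XZ by (simp_all add: inner_quat_def quat_sel_arith re algebra_simps)
  moreover have "(X * Z) \<bullet> (X * Z) = 1"
    using inner_ZZ norm_X by (simp add: norm_eq_1[symmetric] norm_mult_quat)
  moreover have "X \<bullet> 1 = 0" "Z \<bullet> 1 = 0" "Z \<bullet> X = 0" "(X * Z) \<bullet> 1 = 0" "(X * Z) \<bullet> X = 0" "(X * Z) \<bullet> Z = 0"
    using calculation inner_XZ by (simp_all add: inner_commute)
  ultimately show ?thesis
    by (simp add: emb_def inner_add_left inner_add_right inner_XX inner_XZ inner_ZZ)
      (simp add: inner_quat_def)
qed

lemma norm_emb: "norm (emb p) = norm p"
  by (simp add: norm_eq_sqrt_inner emb_inner)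

lemma linear_emb: "linear emb"
  by (rule linearI) (simp_all add: emb_add emb_scale)

lemma emb_eq_iff: "emb p = emb q \<longleftrightarrow> p = q"
  using norm_emb[of "p - q"] linear_diff[OF linear_emb, of p q] by auto

lemma surj_emb: "surj emb"
  by (rule linear_inj_imp_surj[OF linear_emb]) (simp add: inj_def emb_eq_iff)

lemma exp_X: "exp (t *\<^sub>R X) = emb (Quat (cos t) (sin t) 0 0)"
  by (simp add: exp_imaginary_unit[OF XX] emb_def)

lemma exp_Y: "exp (t *\<^sub>R Y) = emb (Quat (cos t) (\<kappa> * sin t) (s * sin t) 0)"
  by (subst exp_imaginary_unit[OF YY]) (subst Y_eq, simp add: emb_def algebra_simps)

lemma norm_exp_control:
  assumes "C \<in> {X, Y}"
  shows "norm (exp (t *\<^sub>R C)) = 1"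
proof -
  have "(\<kappa> * sin t) * (\<kappa> * sin t) + (s * sin t) * (s * sin t) = (\<kappa> * \<kappa> + s * s) * (sin t * sin t)"
    by (simp only: algebra_simps)
  also have "\<dots> = 1 - cos t * cos t"
    using sin_cos_squared_add[of t] by (simp add: s_sq power2_eq_square)
  finally show ?thesis
    using assms sin_cos_squared_add[of t]
    by (auto simp: exp_X exp_Y norm_emb norm_Quat power2_eq_square)
qed

lemma norm_word_val: "admissible {X, Y} w \<Longrightarrow> norm (word_val w) = 1"
  by (induction w) (auto simp: norm_mult_quat norm_exp_control)

section \<open>First-order conditions\<close>

lemma X_neq_Y: "X \<noteq> Y"
  using inner_XY inner_XX \<kappa>_less_1 by (metis less_irrefl)

definition wt where "wt C = (if C = X then 1 else \<kappa>)"

definition D where "D C = wt C *\<^sub>R 1 + C"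

text \<open>The factor \<open>wt C\<close> makes the norm of a product of such exponentials the
  exponential of its cost, so that cost and value of a word are varied together.\<close>

lemma exp_D: "exp (t *\<^sub>R D C) = exp (t * wt C) *\<^sub>R exp (t *\<^sub>R C)"
  unfolding D_def scaleR_add_right
  using exp_of_real[of "t * wt C", where ?'a=quat] by (subst exp_add_commuting) (simp_all add: of_real_def)

lemma has_derivative_exp_D:
  assumes "bounded_linear p"
  shows "((\<lambda>y. exp (p y *\<^sub>R D C)) has_derivative (\<lambda>h. p h *\<^sub>R (exp (p x *\<^sub>R D C) * D C))) (at x)"
proof -
  have "((\<lambda>t. exp (t *\<^sub>R D C)) has_derivative (\<lambda>h. h *\<^sub>R (exp (p x *\<^sub>R D C) * D C))) (at (p x))"
    using exp_scaleR_has_vector_derivative_right by (auto simp: has_vector_derivative_def)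
  from has_derivative_compose[OF bounded_linear_imp_has_derivative[OF assms] this] show ?thesis .
qed

lemma continuous_on_exp_D:
  assumes "bounded_linear p"
  shows "continuous_on UNIV (\<lambda>y. exp (p y *\<^sub>R D C))"
  using has_derivative_continuous[OF has_derivative_exp_D[OF assms]]
  by (simp add: continuous_on_eq_continuous_at)

lemma exp_D_commute: "exp (t *\<^sub>R D C) * D C = D C * exp (t *\<^sub>R D C)"
  using exp_times_scaleR_commute[of t "D C"] by simp

text \<open>The four partial derivatives of \<open>exp(x\<^sub>1D\<^sub>1)exp(x\<^sub>2D\<^sub>2)exp(x\<^sub>3D\<^sub>3)M exp(x\<^sub>4D\<^sub>4)\<close>,
  transported to the point between the second and the third factor, are dependent at an optimal word:
  otherwise the map is open there and the same direction is reached with a smaller norm.\<close>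

lemma n_optimal_dependent:
  assumes opt: "n_optimal X Y \<kappa> n ([(x1, C1), (x2, C2), (x3, C3)] @ m @ [(x4, C4)])"
    and pos: "x1 > 0" "x2 > 0" "x3 > 0" "x4 > 0"
    and V: "word_val m * M' = 1" "V = exp (x3 *\<^sub>R C3) * word_val m" "V' = M' * exp (- (x3 *\<^sub>R C3))"
  shows "\<exists>h1 h2 h3 h4. (h1, h2, h3, h4) \<noteq> (0, 0, 0, 0) \<and>
    h1 *\<^sub>R (exp (- (x2 *\<^sub>R C2)) * D C1 * exp (x2 *\<^sub>R C2)) + h2 *\<^sub>R D C2 + h3 *\<^sub>R D C3
      + h4 *\<^sub>R (V * D C4 * V') = 0"
proof (rule ccontr)
  assume neg: "\<not> ?thesis"
  define M where "M = word_val m"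
  define p1 p2 p3 p4 :: "real \<times> real \<times> real \<times> real \<Rightarrow> real"
    where p: "p1 = fst" "p2 = (\<lambda>y. fst (snd y))" "p3 = (\<lambda>y. fst (snd (snd y)))" "p4 = (\<lambda>y. snd (snd (snd y)))"
  have bl: "bounded_linear p1" "bounded_linear p2" "bounded_linear p3" "bounded_linear p4"
    unfolding p by (intro bounded_linear_intros)+
  define F where "F y = exp (p1 y *\<^sub>R D C1) * exp (p2 y *\<^sub>R D C2) * exp (p3 y *\<^sub>R D C3) * M
    * exp (p4 y *\<^sub>R D C4)" for y
  define x where "x = (x1, x2, x3, x4)"
  have px: "p1 x = x1" "p2 x = x2" "p3 x = x3" "p4 x = x4"
    by (simp_all add: p x_def)
  define E1 E2 E3 E4 where E: "E1 = exp (x1 *\<^sub>R D C1)" "E2 = exp (x2 *\<^sub>R D C2)"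
    "E3 = exp (x3 *\<^sub>R D C3)" "E4 = exp (x4 *\<^sub>R D C4)"
  define I1 I2 I3 I4 where I: "I1 = exp (- (x1 *\<^sub>R D C1))" "I2 = exp (- (x2 *\<^sub>R D C2))"
    "I3 = exp (- (x3 *\<^sub>R D C3))" "I4 = exp (- (x4 *\<^sub>R D C4))"
  have EI: "I1 * E1 = 1" "I2 * E2 = 1" "E3 * I3 = 1" "E4 * I4 = 1"
    unfolding E I using exp_minus_inverse[of "- (_ *\<^sub>R D _)"] exp_minus_inverse[of "_ *\<^sub>R D _"] by simp_all
  have EI': "I1 * (E1 * q) = q" "I2 * (E2 * q) = q" "E3 * (I3 * q) = q" "E4 * (I4 * q) = q" "M * (M' * q) = q" for q
    using V(1) by (simp_all add: mult.assoc[symmetric] EI M_def)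
  have comm: "E3 * D C3 = D C3 * E3" "E4 * D C4 = D C4 * E4"
    by (simp_all add: E exp_D_commute)
  have comm': "E3 * (D C3 * q) = D C3 * (E3 * q)" "E4 * (D C4 * q) = D C4 * (E4 * q)" for q
    by (simp_all add: mult.assoc[symmetric] comm)
  define F' where "F' h = p1 h *\<^sub>R (E1 * D C1 * E2 * E3 * M * E4) + p2 h *\<^sub>R (E1 * E2 * D C2 * E3 * M * E4)
    + p3 h *\<^sub>R (E1 * E2 * E3 * D C3 * M * E4) + p4 h *\<^sub>R (E1 * E2 * E3 * M * E4 * D C4)" for h
  have "(F has_derivative F') (at x)"
    unfolding F_def F'_def
    by (rule has_derivative_eq_rhs, (rule has_derivative_mult has_derivative_exp_D bl has_derivative_const)+)
      (simp add: fun_eq_iff px E algebra_simps)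
  moreover have "h = 0" if "F' h = 0" for h
  proof -
    \<comment> \<open>Two inverses on the left and three on the right move all four partial
      derivatives between the second and third factors. Exponentials commute with their own
      generators, and the real weights cancel in conjugations.\<close>
    have "0 = I2 * I1 * F' h * I4 * M' * I3"
      by (simp add: that)
    also have "\<dots> = p1 h *\<^sub>R (I2 * D C1 * E2) + p2 h *\<^sub>R D C2 + p3 h *\<^sub>R D C3
      + p4 h *\<^sub>R (E3 * M * D C4 * M' * I3)"
      by (simp add: F'_def distrib_left distrib_right mult.assoc EI EI' comm comm')
    also have "I2 * D C1 * E2 = exp (- (x2 *\<^sub>R C2)) * D C1 * exp (x2 *\<^sub>R C2)"
      using exp_D[of x2 C2] exp_D[of "- x2" C2] by (simp add: E I exp_minus_inverse flip: exp_add)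
    also have "E3 * M * D C4 * M' * I3 = V * D C4 * V'"
      using exp_D[of x3 C3] exp_D[of "- x3" C3] by (simp add: E I V M_def mult.assoc flip: exp_add)
    finally have "p1 h = 0 \<and> p2 h = 0 \<and> p3 h = 0 \<and> p4 h = 0"
      using neg by (metis Pair_inject)
    then show "h = 0"
      by (simp add: p prod_eq_iff)
  qed
  moreover have "continuous_on UNIV F"
    unfolding F_def
    by (intro continuous_on_mult continuous_on_const continuous_on_exp_D bl)
  moreover define T where "T = {0::real<..} \<times> {0::real<..} \<times> {0::real<..} \<times> {0::real<..}"
  moreover have "open T" "x \<in> T"
    using pos by (simp_all add: T_def x_def open_Times)
  ultimately obtain y r where y: "y \<in> T" and r: "0 < r" "r < 1" "F y = r *\<^sub>R F x"
    using inj_derivative_scaled_value[of F F' x T] by (auto simp: Basis_quat_def)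
  define W where "W y = [(p1 y, C1), (p2 y, C2), (p3 y, C3)] @ m @ [(p4 y, C4)]" for y
  \<comment> \<open>\<open>F\<close> contains the value of \<open>m\<close> but not its weight, so
    the constant \<open>exp (cost X \<kappa> m)\<close> is supplied here.\<close>
  have F_W: "exp (cost X \<kappa> m) *\<^sub>R F y = exp (cost X \<kappa> (W y)) *\<^sub>R word_val (W y)" for y
  proof -
    have "cost X \<kappa> (W y) = p1 y * wt C1 + p2 y * wt C2 + p3 y * wt C3 + cost X \<kappa> m + p4 y * wt C4"
      by (simp add: W_def wt_def)
    then have "exp (cost X \<kappa> (W y)) = exp (cost X \<kappa> m) * (exp (p1 y * wt C1) * exp (p2 y * wt C2) * exp (p3 y * wt C3) * exp (p4 y * wt C4))"
      by (simp only: exp_add mult_ac)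
    then show ?thesis
      by (simp only: F_def W_def exp_D M_def) (simp add: mult.assoc mult.left_commute)
  qed
  have Wx: "W x = [(x1, C1), (x2, C2), (x3, C3)] @ m @ [(x4, C4)]"
    by (simp add: W_def px)
  have admx: "admissible {X, Y} (W x)" and "length (W x) = n"
    using opt unfolding n_optimal_def Wx by blast+
  then have len: "length (W y) = n"
    by (simp add: W_def)
  have admy: "admissible {X, Y} (W y)"
    using admx y by (auto simp: W_def p x_def T_def)
  have eq: "exp (cost X \<kappa> (W y)) *\<^sub>R word_val (W y) = (r * exp (cost X \<kappa> (W x))) *\<^sub>R word_val (W x)"
    using F_W[of y] F_W[of x] r(3) by (metis scaleR_scaleR mult.commute)
  \<comment> \<open>Word values have norm 1, so comparing norms compares costs alone, and the factor
    \<open>r < 1\<close> becomes a drop in cost.\<close>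
  from arg_cong[OF this, of norm] have c: "exp (cost X \<kappa> (W y)) = r * exp (cost X \<kappa> (W x))"
    using r norm_word_val[OF admx] norm_word_val[OF admy] by simp
  then have "word_val (W y) = word_val (W x)"
    using eq by (metis exp_not_eq_zero scaleR_left_imp_eq)
  moreover have "exp (cost X \<kappa> (W y)) < exp (cost X \<kappa> (W x))"
    unfolding c using r by simp
  ultimately show False
    using opt admy len unfolding n_optimal_def Wx[symmetric] by (metis exp_less_cancel_iff not_le)
qed

text \<open>Here \<kappa> = cos \<alpha> enters: the weight of \<open>Y\<close> equals its
  X-coordinate, so \<open>qRe\<close> and \<open>qIm1\<close> agree in these coordinates for both
  generators.\<close>

lemma D_X: "D X = emb (Quat 1 1 0 0)" and D_Y: "D Y = emb (Quat \<kappa> \<kappa> s 0)"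
  using X_neq_Y by (simp_all add: D_def wt_def emb_def) (metis Y_eq)

text \<open>A rotation about the X-axis by the angle \<open>2 * b\<close>, which is the origin of
  the condition on \<open>sin (2 * b)\<close>.\<close>

lemma conj_X:
  "exp (- (b *\<^sub>R X)) * emb (Quat r x z w) * exp (b *\<^sub>R X)
    = emb (Quat r x (z * cos (2 * b) + w * sin (2 * b)) (w * cos (2 * b) - z * sin (2 * b)))"
proof -
  have "Quat (cos b) (- sin b) 0 0 * Quat r x z w * Quat (cos b) (sin b) 0 0
    = Quat r x (z * cos (2 * b) + w * sin (2 * b)) (w * cos (2 * b) - z * sin (2 * b))"
    using sin_cos_squared_add[of b]
    by (simp add: quat_eq_iff quat_sel_arith cos_double sin_double; algebra)
  then show ?thesis
    using exp_X[of "- b"] by (simp add: exp_X flip: emb_mult)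
qed

lemma conj_Y:
  "exp (- (t *\<^sub>R Y)) * D X * exp (t *\<^sub>R Y)
    = emb (Quat 1 (1 - 2 * s\<^sup>2 * (sin t)\<^sup>2) (2 * \<kappa> * s * (sin t)\<^sup>2) (2 * s * sin t * cos t))"
proof -
  have "Quat (cos t) (- (\<kappa> * sin t)) (- (s * sin t)) 0 * Quat 1 1 0 0 * Quat (cos t) (\<kappa> * sin t) (s * sin t) 0
    = Quat 1 (1 - 2 * s\<^sup>2 * (sin t)\<^sup>2) (2 * \<kappa> * s * (sin t)\<^sup>2) (2 * s * sin t * cos t)"
    using sin_cos_squared_add[of t] s_sq
    by (simp add: quat_eq_iff quat_sel_arith; algebra)
  then show ?thesis
    using exp_Y[of "- t"] by (simp add: exp_Y D_X flip: emb_mult)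
qed

lemma emb_components:
  assumes "h1 *\<^sub>R emb q1 + h2 *\<^sub>R emb q2 + h3 *\<^sub>R emb q3 + h4 *\<^sub>R emb q4 = 0" and "f \<in> {qRe, qIm1, qIm2, qIm3}"
  shows "h1 * f q1 + h2 * f q2 + h3 * f q3 + h4 * f q4 = 0"
proof -
  have "h1 *\<^sub>R q1 + h2 *\<^sub>R q2 + h3 *\<^sub>R q3 + h4 *\<^sub>R q4 = 0"
    using assms(1) by (metis emb_0 emb_add emb_eq_iff emb_scale)
  then show ?thesis
    using assms(2) by (auto simp: quat_eq_iff quat_sel_arith)
qed

section \<open>Conditions on windows of four and five letters\<close>

text \<open>The functional \<open>qRe - qIm1\<close> vanishes on all terms except the Y-conjugate of
  \<open>D X\<close>, where it is \<open>2 * s\<^sup>2 * (sin t)\<^sup>2\<close>; so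
  \<open>h4 = 0\<close>. The XZ-coordinate then leaves a multiple of
  \<open>h1 * sin (2 * b)\<close>, and \<open>D X\<close>, \<open>D Y\<close> are
  independent.\<close>

lemma middle_X_in_YXYX:
  assumes opt: "n_optimal X Y \<kappa> n [(a, Y), (b, X), (t, Y), (d, X)]"
    and pos: "a > 0" "b > 0" "t > 0" "d > 0" and t: "sin t \<noteq> 0"
  shows "sin (2 * b) = 0"
proof (rule ccontr)
  assume b: "sin (2 * b) \<noteq> 0"
  obtain h1 h2 h3 h4 where h: "(h1, h2, h3, h4) \<noteq> (0, 0, 0, 0)"
    "h1 *\<^sub>R (exp (- (b *\<^sub>R X)) * D Y * exp (b *\<^sub>R X)) + h2 *\<^sub>R D X + h3 *\<^sub>R D Y
      + h4 *\<^sub>R (exp (t *\<^sub>R Y) * D X * exp (- (t *\<^sub>R Y))) = 0"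
    using n_optimal_dependent[of n a Y b X t Y "[]" d X 1, OF _ pos _ refl refl] opt by auto
  note e = emb_components[OF h(2)[unfolded D_Y conj_X, folded D_Y, unfolded conj_Y[of "- t", simplified], unfolded D_X D_Y]]
  have "h4 * (2 * s\<^sup>2 * (sin t)\<^sup>2) = 0"
    using e[of qRe] e[of qIm1] by (simp add: algebra_simps)
  then have "h4 = 0"
    using t s_pos by simp
  with e[of qIm3] have "h1 = 0"
    using b s_pos by simp
  with \<open>h4 = 0\<close> e[of qIm2] e[of qRe] h(1) s_pos show False
    by simp
qed

text \<open>The mirror image of the previous window: the first and last derivatives exchange
  roles.\<close>

lemma middle_X_in_XYXY:
  assumes opt: "n_optimal X Y \<kappa> n [(d, X), (t, Y), (b, X), (a, Y)]"
    and pos: "d > 0" "t > 0" "b > 0" "a > 0" and t: "sin t \<noteq> 0"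
  shows "sin (2 * b) = 0"
proof (rule ccontr)
  assume b: "sin (2 * b) \<noteq> 0"
  obtain h1 h2 h3 h4 where h: "(h1, h2, h3, h4) \<noteq> (0, 0, 0, 0)"
    "h1 *\<^sub>R (exp (- (t *\<^sub>R Y)) * D X * exp (t *\<^sub>R Y)) + h2 *\<^sub>R D Y + h3 *\<^sub>R D X
      + h4 *\<^sub>R (exp (b *\<^sub>R X) * D Y * exp (- (b *\<^sub>R X))) = 0"
    using n_optimal_dependent[of n d X t Y b X "[]" a Y 1, OF _ pos _ refl refl] opt by auto
  note e = emb_components[OF h(2)[unfolded conj_Y D_Y conj_X[of "- b", simplified], unfolded D_X]]
  have "h1 * (2 * s\<^sup>2 * (sin t)\<^sup>2) = 0"
    using e[of qRe] e[of qIm1] by (simp add: algebra_simps)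
  then have "h1 = 0"
    using t s_pos by simp
  with e[of qIm3] have "h4 = 0"
    using b s_pos by simp
  with \<open>h1 = 0\<close> e[of qIm2] e[of qRe] h(1) s_pos show False
    by simp
qed

text \<open>The letter of time \<open>u\<close> is held fixed. Conjugation by
  \<open>exp ((pi / 2) *\<^sub>R X)\<close> only negates the Z- and XZ-coordinates, so
  \<open>qRe - qIm1\<close> and the XZ-coordinate give two equations for \<open>h1\<close> and
  \<open>h4\<close>, whose determinant is a nonzero multiple of
  \<open>sin t * sin u * sin (t - u)\<close>.\<close>

lemma middle_Y_in_XYXYX:
  assumes opt: "n_optimal X Y \<kappa> n [(a, X), (t, Y), (pi / 2, X), (u, Y), (d, X)]"
    and pos: "a > 0" "t > 0" "u > 0" "d > 0" and sin: "sin t \<noteq> 0" "sin u \<noteq> 0"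
  shows "sin (t - u) = 0"
proof (rule ccontr)
  assume tu: "sin (t - u) \<noteq> 0"
  obtain h1 h2 h3 h4 where h: "(h1, h2, h3, h4) \<noteq> (0, 0, 0, 0)"
    "h1 *\<^sub>R (exp (- (t *\<^sub>R Y)) * D X * exp (t *\<^sub>R Y)) + h2 *\<^sub>R D Y + h3 *\<^sub>R D X
      + h4 *\<^sub>R (exp ((pi / 2) *\<^sub>R X) * exp (u *\<^sub>R Y) * D X * (exp (- (u *\<^sub>R Y)) * exp (- ((pi / 2) *\<^sub>R X)))) = 0"
    using n_optimal_dependent[of n a X t Y "pi / 2" X "[(u, Y)]" d X "exp (- (u *\<^sub>R Y))", OF _ pos(1,2) _ pos(4) _ refl refl] opt
    by (auto simp: exp_minus_inverse)
  have assoc: "exp ((pi / 2) *\<^sub>R X) * exp (u *\<^sub>R Y) * D X * (exp (- (u *\<^sub>R Y)) * exp (- ((pi / 2) *\<^sub>R X)))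
     = exp ((pi / 2) *\<^sub>R X) * (exp (u *\<^sub>R Y) * D X * exp (- (u *\<^sub>R Y))) * exp (- ((pi / 2) *\<^sub>R X))"
    by (simp add: mult.assoc)
  note e = emb_components[OF h(2)[unfolded assoc conj_Y conj_Y[of "- u", simplified] conj_X[of "- (pi / 2)", simplified],
    unfolded D_X D_Y]]
  have "h1 * (2 * s\<^sup>2 * (sin t)\<^sup>2) + h4 * (2 * s\<^sup>2 * (sin u)\<^sup>2) = 0"
    using e[of qRe] e[of qIm1] by (simp add: algebra_simps)
  then have "(2 * s\<^sup>2) * (h1 * (sin t)\<^sup>2 + h4 * (sin u)\<^sup>2) = 0"
    by (simp add: algebra_simps)
  then have 1: "h1 * (sin t)\<^sup>2 + h4 * (sin u)\<^sup>2 = 0"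
    using s_pos by simp
  have "(2 * s) * (h1 * sin t * cos t + h4 * sin u * cos u) = 0"
    using e[of qIm3] by (simp add: algebra_simps)
  then have 2: "h1 * sin t * cos t + h4 * sin u * cos u = 0"
    using s_pos by simp
  have "h1 * sin t * sin (t - u) = 0"
    using 1 2 by (simp add: sin_diff power2_eq_square) (use sin in algebra)
  then have "h1 = 0"
    using sin tu by simp
  with 1 have "h4 = 0"
    using sin by simp
  with \<open>h1 = 0\<close> e[of qIm2] e[of qRe] h(1) s_pos show False
    by simp
qed

section \<open>Short middle letters\<close>

lemma Quat_XYX:
  "Quat (cos d) (sin d) 0 0 * Quat (cos t) (\<kappa> * sin t) (s * sin t) 0 * Quat (cos d) (sin d) 0 0
    = Quat (cos t * cos (2 * d) - \<kappa> * sin t * sin (2 * d)) (cos t * sin (2 * d) + \<kappa> * sin t * cos (2 * d)) (s * sin t) 0"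
  using sin_cos_squared_add[of d]
  by (simp add: quat_eq_iff quat_sel_arith cos_double sin_double; algebra)

text \<open>Palindromic words have no \<open>XZ\<close>-component. The component orthogonal to \<open>1\<close> and \<open>Y\<close>
  determines \<open>e\<close>, and the argument in the plane of \<open>1\<close> and \<open>Y\<close> determines \<open>\<sigma>\<close>.\<close>

lemma XYX_eq_YXY:
  fixes t d e \<sigma> :: real
  defines "a \<equiv> cos t * cos (2 * d) - \<kappa> * sin t * sin (2 * d)"
    and "b \<equiv> \<kappa> * (cos t * sin (2 * d) + \<kappa> * sin t * cos (2 * d)) + s * s * sin t"
  assumes e: "sin e = cos t * sin (2 * d) + \<kappa> * sin t * cos (2 * d) - \<kappa> * sin t" and "cos e > 0" "a > 0"
    and \<sigma>: "2 * \<sigma> = arctan (b / a) - arctan (\<kappa> * sin e / cos e)"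
  shows "exp (d *\<^sub>R X) * exp (t *\<^sub>R Y) * exp (d *\<^sub>R X) = exp (\<sigma> *\<^sub>R Y) * exp (e *\<^sub>R X) * exp (\<sigma> *\<^sub>R Y)"
proof -
  define c1 s1 where "c1 = cos (2 * \<sigma>)" and "s1 = sin (2 * \<sigma>)"
  \<comment> \<open>The squared length of the component in the plane of 1 and \<open>Y\<close>. It
    is the same for both words, as both have norm 1 and the same orthogonal component
    \<open>s * sin e\<close>.\<close>
  define R where "R = a\<^sup>2 + b\<^sup>2"
  have d2: "(sin (2 * d))\<^sup>2 + (cos (2 * d))\<^sup>2 = 1" and t2: "(sin t)\<^sup>2 + (cos t)\<^sup>2 = 1"
    and e2: "(sin e)\<^sup>2 + (cos e)\<^sup>2 = 1"
    by simp_all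
  have R: "R = (cos e)\<^sup>2 + (\<kappa> * sin e)\<^sup>2"
    unfolding R_def a_def b_def using s_sq d2 t2 e2 e by algebra
  have "R > 0"
    using \<open>a > 0\<close> by (simp add: R_def sum_power2_gt_zero_iff)
  define \<phi> \<psi> where "\<phi> = arctan (b / a)" and "\<psi> = arctan (\<kappa> * sin e / cos e)"
  have ab: "a = sqrt R * cos \<phi>" "b = sqrt R * sin \<phi>"
    using polar_arctan[OF \<open>a > 0\<close>, of b] by (simp_all add: R_def \<phi>_def)
  have ce: "cos e = sqrt R * cos \<psi>" "\<kappa> * sin e = sqrt R * sin \<psi>"
    using polar_arctan[OF \<open>cos e > 0\<close>, of "\<kappa> * sin e"] by (simp_all add: R \<psi>_def)
  have "c1 = cos \<phi> * cos \<psi> + sin \<phi> * sin \<psi>" "s1 = sin \<phi> * cos \<psi> - cos \<phi> * sin \<psi>"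
    unfolding c1_def s1_def \<sigma> \<phi>_def \<psi>_def by (simp_all only: cos_diff sin_diff)
  then have eqs: "a = cos e * c1 - \<kappa> * sin e * s1" "b = cos e * s1 + \<kappa> * sin e * c1"
    using ab ce sin_cos_squared_add[of \<psi>] by algebra+
  have "Quat (cos d) (sin d) 0 0 * Quat (cos t) (\<kappa> * sin t) (s * sin t) 0 * Quat (cos d) (sin d) 0 0
      = Quat a (cos t * sin (2 * d) + \<kappa> * sin t * cos (2 * d)) (s * sin t) 0"
    by (simp add: a_def Quat_XYX)
  \<comment> \<open>The imaginary part in the orthonormal basis \<open>Y\<close>,
    \<open>s X - \<kappa> Z\<close>. Multiplication by \<open>exp(\<sigma>Y)\<close> on both sides
    turns the plane of 1 and \<open>Y\<close> by \<open>2 * \<sigma>\<close> and fixes the second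
    basis vector.\<close>
  also have "\<dots> = Quat a (\<kappa> * b + s * (s * sin e)) (s * b - \<kappa> * (s * sin e)) 0"
    unfolding e b_def using s_sq by (simp; algebra)
  also have "\<dots> = Quat (cos \<sigma>) (\<kappa> * sin \<sigma>) (s * sin \<sigma>) 0 * Quat (cos e) (sin e) 0 0
      * Quat (cos \<sigma>) (\<kappa> * sin \<sigma>) (s * sin \<sigma>) 0"
    unfolding eqs c1_def s1_def using sin_cos_squared_add[of \<sigma>] s_sq
    by (simp add: quat_eq_iff quat_sel_arith cos_double sin_double; algebra)
  finally show ?thesis
    by (simp add: exp_X exp_Y flip: emb_mult)
qed

text \<open>Along the family of \<open>XYX_eq_YXY\<close>, parametrised by \<open>d\<close>, the cost difference
  \<open>e + 2\<kappa>\<sigma> - 2d - \<kappa>t\<close> has derivative \<open>-2(1 - cos t)(1 - \<kappa>\<^sup>2) < 0\<close> at \<open>d = 0\<close>.\<close>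

lemma short_Y_between_X_improvable:
  assumes t: "0 < t" "t < pi / 2" and m: "m > 0"
  shows "\<exists>d e \<sigma>. 0 < d \<and> d < m \<and> 0 < e \<and> 0 < \<sigma> \<and>
    exp (d *\<^sub>R X) * exp (t *\<^sub>R Y) * exp (d *\<^sub>R X) = exp (\<sigma> *\<^sub>R Y) * exp (e *\<^sub>R X) * exp (\<sigma> *\<^sub>R Y) \<and>
    e + 2 * \<kappa> * \<sigma> < 2 * d + \<kappa> * t"
proof -
  define a where "a d = cos t * cos (2 * d) - \<kappa> * sin t * sin (2 * d)" for d
  define b where "b d = \<kappa> * (cos t * sin (2 * d) + \<kappa> * sin t * cos (2 * d)) + s * s * sin t" for d
  define u where "u d = cos t * sin (2 * d) + \<kappa> * sin t * cos (2 * d) - \<kappa> * sin t" for d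
  define e where "e d = arcsin (u d)" for d
  define \<sigma> where "\<sigma> d = (arctan (b d / a d) - arctan (\<kappa> * sin (e d) / cos (e d))) / 2" for d
  define f where "f d = e d + 2 * \<kappa> * \<sigma> d - 2 * d - \<kappa> * t" for d
  have ct: "cos t > 0" and st: "sin t > 0"
    using t by (auto intro: cos_gt_zero sin_gt_zero)
  have ct1: "cos t < 1"
    using t cos_monotone_0_pi[of 0 t] by simp
  have "b 0 = (\<kappa> * \<kappa> + s * s) * sin t"
    by (simp add: b_def algebra_simps)
  then have at0: "a 0 = cos t" "b 0 = sin t" "u 0 = 0" "e 0 = 0"
    using s_sq by (simp_all add: a_def u_def e_def)
  have da: "(a has_real_derivative - 2 * \<kappa> * sin t) (at 0)"
    unfolding a_def by (auto intro!: derivative_eq_intros)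
  have db: "(b has_real_derivative 2 * \<kappa> * cos t) (at 0)"
    unfolding b_def by (auto intro!: derivative_eq_intros)
  have du: "(u has_real_derivative 2 * cos t) (at 0)"
    unfolding u_def by (auto intro!: derivative_eq_intros)
  have de: "(e has_real_derivative 2 * cos t) (at 0)"
    unfolding e_def by (auto intro!: derivative_eq_intros du simp: at0)
  have "((\<lambda>d. arctan (b d / a d)) has_real_derivative 2 * \<kappa>) (at 0)"
  proof (rule DERIV_cong)
    show "((\<lambda>d. arctan (b d / a d)) has_real_derivative
        inverse (1 + (b 0 / a 0)\<^sup>2) * ((2 * \<kappa> * cos t * a 0 - b 0 * (- 2 * \<kappa> * sin t)) / (a 0 * a 0))) (at 0)"
      using ct by (intro DERIV_chain2[OF DERIV_arctan] DERIV_divide da db) (simp add: at0)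
    have "(2 * \<kappa> * cos t * a 0 - b 0 * (- 2 * \<kappa> * sin t)) = 2 * \<kappa>" "1 + (b 0 / a 0)\<^sup>2 = 1 / (cos t * cos t)"
      using ct sin_cos_squared_add[of t] unfolding at0 by (algebra, simp add: field_simps power2_eq_square)
    then show "inverse (1 + (b 0 / a 0)\<^sup>2) * ((2 * \<kappa> * cos t * a 0 - b 0 * (- 2 * \<kappa> * sin t)) / (a 0 * a 0)) = 2 * \<kappa>"
      using ct by (simp add: at0)
  qed
  moreover have "((\<lambda>d. arctan (\<kappa> * sin (e d) / cos (e d))) has_real_derivative 2 * \<kappa> * cos t) (at 0)"
    by (auto intro!: derivative_eq_intros de simp: at0)
  ultimately have d\<sigma>: "(\<sigma> has_real_derivative (2 * \<kappa> - 2 * \<kappa> * cos t) / 2) (at 0)"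
    unfolding \<sigma>_def by (intro DERIV_cdivide DERIV_diff)
  have df: "(f has_real_derivative 2 * cos t + 2 * \<kappa> * ((2 * \<kappa> - 2 * \<kappa> * cos t) / 2) - 2) (at 0)"
    unfolding f_def by (auto intro!: derivative_eq_intros de d\<sigma>)
  moreover have "2 * cos t + 2 * \<kappa> * ((2 * \<kappa> - 2 * \<kappa> * cos t) / 2) - 2 = - 2 * ((1 - cos t) * (s * s))"
    unfolding s_sq by algebra
  moreover have "(1 - cos t) * (s * s) > 0"
    using ct1 s_pos by simp
  ultimately have "2 * cos t + 2 * \<kappa> * ((2 * \<kappa> - 2 * \<kappa> * cos t) / 2) - 2 < 0"
    by simp
  from DERIV_neg_dec_right[OF df this]
  obtain d1 where d1: "d1 > 0" "\<And>h. 0 < h \<Longrightarrow> h < d1 \<Longrightarrow> f h < f 0"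
    by auto
  obtain d2 where d2: "d2 > 0" "\<And>h. 0 < h \<Longrightarrow> h < d2 \<Longrightarrow> u 0 < u h"
    using DERIV_pos_inc_right[OF du] ct by auto
  \<comment> \<open>At \<open>d = 0\<close> both words reduce to \<open>exp(tY)\<close>, so the cost
    difference starts from 0; \<open>t < pi / 2\<close> lets arctan invert tan.\<close>
  have \<sigma>0: "\<sigma> 0 = t / 2"
    using t arctan_tan[of t] by (simp add: \<sigma>_def at0 tan_def)
  then have f0: "f 0 = 0"
    by (simp add: f_def at0)
  have "(u \<longlongrightarrow> 0) (at_right 0)" "(a \<longlongrightarrow> cos t) (at_right 0)" "(\<sigma> \<longlongrightarrow> t / 2) (at_right 0)"
    using DERIV_isCont[OF du] DERIV_isCont[OF da] DERIV_isCont[OF d\<sigma>]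
    unfolding isCont_def at0 \<sigma>0 by (blast intro: filterlim_at_within_If tendsto_within_subset subset_UNIV)+
  \<comment> \<open>For small \<open>d\<close> the arcsine stays in its regular range, arctan still
    gives the argument, and \<sigma> remains an admissible time.\<close>
  then have "eventually (\<lambda>d. u d < 1) (at_right 0)" "eventually (\<lambda>d. a d > 0) (at_right 0)"
    "eventually (\<lambda>d. \<sigma> d > 0) (at_right 0)"
    using order_tendstoD(2)[of u 0 "at_right 0" 1] order_tendstoD(1)[of a "cos t" "at_right 0" 0]
      order_tendstoD(1)[of \<sigma> "t / 2" "at_right 0" 0] ct t by auto
  moreover have "eventually (\<lambda>d. 0 < d \<and> d < min m (min d1 d2)) (at_right 0)"
    using eventually_at_right_real[of 0 "min m (min d1 d2)"] m d1 d2 by auto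
  ultimately have "eventually (\<lambda>d. u d < 1 \<and> a d > 0 \<and> \<sigma> d > 0 \<and> 0 < d \<and> d < min m (min d1 d2)) (at_right 0)"
    by eventually_elim auto
  then obtain d where d: "u d < 1" "a d > 0" "\<sigma> d > 0" "0 < d" "d < m" "d < d1" "d < d2"
    using eventually_happens'[OF trivial_limit_at_right_real] by auto
  have u: "u d > 0"
    using d2(2)[of d] d at0 by simp
  have e: "0 < e d" "e d < pi / 2" "sin (e d) = u d"
    using u d arcsin_less_arcsin[of 0 "u d"] arcsin_less_arcsin[of "u d" 1] by (auto simp: e_def)
  have "exp (d *\<^sub>R X) * exp (t *\<^sub>R Y) * exp (d *\<^sub>R X)
      = exp (\<sigma> d *\<^sub>R Y) * exp (e d *\<^sub>R X) * exp (\<sigma> d *\<^sub>R Y)"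
    by (rule XYX_eq_YXY) (use e d in \<open>auto simp: u_def a_def b_def \<sigma>_def intro: cos_gt_zero\<close>)
  moreover have "e d + 2 * \<kappa> * \<sigma> d < 2 * d + \<kappa> * t"
    using d1(2)[of d] d f0 by (simp add: f_def)
  ultimately show ?thesis
    using d e by blast
qed

section \<open>Reachability and words of fixed length\<close>

lemma exp_control: "C \<in> {X, Y} \<Longrightarrow> exp (t *\<^sub>R C) = cos t *\<^sub>R 1 + sin t *\<^sub>R C"
  using exp_imaginary_unit[OF XX] exp_imaginary_unit[OF YY] by auto

lemma exp_control_periodic:
  assumes "C \<in> {X, Y}"
  shows "exp ((t + 2 * pi * of_int k) *\<^sub>R C) = exp (t *\<^sub>R C)"
  unfolding exp_control[OF assms] by (simp add: cos_add sin_add)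

lemma exp_control_add_pi:
  assumes "C \<in> {X, Y}"
  shows "exp ((t + pi) *\<^sub>R C) = - exp (t *\<^sub>R C)"
  unfolding exp_control[OF assms] by simp

text \<open>With \<open>\<theta>\<close> small, \<open>exp(\<theta>Z)\<close> is a word \<open>XYX\<close>; its powers give every \<open>exp(\<theta>Z)\<close>, and the Euler
  angle decomposition \<open>exp(pX)exp(\<theta>Z)exp(qX)\<close> then gives all of \<open>SU2\<close> with boundedly many letters.\<close>

definition reach where "reach n g \<longleftrightarrow> (\<exists>w. admissible {X, Y} w \<and> length w = n \<and> word_val w = g)"

lemma reach_mult: "reach m g \<Longrightarrow> reach n h \<Longrightarrow> reach (m + n) (g * h)"
  unfolding reach_def by (metis admissible_simps(3) length_append word_val_simps(3))

lemma reach_exp: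
  assumes "C \<in> {X, Y}"
  shows "reach 1 (exp (t *\<^sub>R C))"
proof -
  define t' where "t' = t + 2 * pi * of_int \<lceil>\<bar>t\<bar>\<rceil>"
  have "\<bar>t\<bar> \<le> 1 * of_int \<lceil>\<bar>t\<bar>\<rceil>"
    by simp
  also have "\<dots> \<le> 2 * pi * of_int \<lceil>\<bar>t\<bar>\<rceil>"
    using pi_ge_two by (intro mult_right_mono) auto
  finally have "t' \<ge> 0"
    by (simp add: t'_def)
  then show ?thesis
    using assms exp_control_periodic[OF assms, of t]
    by (intro exI[of _ "[(t', C)]"] reach_def[THEN iffD2]) (auto simp: t'_def)
qed

text \<open>A letter \<open>Y\<close> with \<open>s * sin t = sin \<theta>\<close> has the required
  Z-coordinate; the bound on \<open>sin \<theta>\<close> makes \<open>t\<close> exist. Two equal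
  letters \<open>X\<close> around it rotate its part in the plane of 1 and \<open>X\<close> onto the
  real axis.\<close>

lemma reach_rotation_Z:
  assumes "0 \<le> sin \<theta>" "sin \<theta> \<le> s"
  shows "reach 3 (emb (Quat (cos \<theta>) 0 (sin \<theta>) 0))"
proof -
  define t where "t = arcsin (sin \<theta> / s)"
  have st: "sin t = sin \<theta> / s"
    unfolding t_def using assms s_pos by (intro sin_arcsin) (auto intro: order_trans[of _ 0])
  then have sst: "sin \<theta> = s * sin t"
    using s_pos by simp
  have sum: "(cos t)\<^sup>2 + (\<kappa> * sin t)\<^sup>2 = (cos \<theta>)\<^sup>2"
    using sst s_sq sin_cos_squared_add[of t] sin_cos_squared_add[of \<theta>] by algebra
  \<comment> \<open>The signed length \<open>cos \<theta>\<close> may be negative; if it is 0, the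
    planar part vanishes and any angle serves.\<close>
  obtain \<phi> where \<phi>: "cos t = cos \<theta> * cos \<phi>" "\<kappa> * sin t = cos \<theta> * sin \<phi>"
  proof (cases "cos \<theta> = 0")
    case True
    then have "cos t = 0" "\<kappa> * sin t = 0"
      using sum by (auto simp: sum_power2_eq_zero_iff)
    then show ?thesis
      using that[of 0] True by simp
  next
    case False
    then have "(cos t / cos \<theta>)\<^sup>2 + (\<kappa> * sin t / cos \<theta>)\<^sup>2 = 1"
      using sum by (simp add: power_divide add_divide_distrib[symmetric])
    then obtain \<phi> where "cos t / cos \<theta> = cos \<phi>" "\<kappa> * sin t / cos \<theta> = sin \<phi>"
      by (rule sincos_total_2pi)
    then show ?thesis
      using that[of \<phi>] False by (simp add: field_simps)
  qed
  have "cos t * cos (- \<phi>) - \<kappa> * sin t * sin (- \<phi>) = cos \<theta>"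
    unfolding \<phi> cos_minus sin_minus using sin_cos_squared_add[of \<phi>] by algebra
  moreover have "cos t * sin (- \<phi>) + \<kappa> * sin t * cos (- \<phi>) = 0"
    unfolding \<phi> by simp
  ultimately have "exp ((- \<phi> / 2) *\<^sub>R X) * exp (t *\<^sub>R Y) * exp ((- \<phi> / 2) *\<^sub>R X) = emb (Quat (cos \<theta>) 0 (sin \<theta>) 0)"
    unfolding exp_X exp_Y emb_mult[symmetric] Quat_XYX by (simp add: sst)
  then show ?thesis
    using reach_mult[OF reach_mult[OF reach_exp[of X "- \<phi> / 2"] reach_exp[of Y t]] reach_exp[of X "- \<phi> / 2"]]
    by (simp add: numeral_3_eq_3)
qed

lemma reach_rotation_Z_power:
  assumes "0 \<le> sin \<theta>" "sin \<theta> \<le> s"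
  shows "reach (3 * n) (emb (Quat (cos (n * \<theta>)) 0 (sin (n * \<theta>)) 0))"
proof (induction n)
  case 0
  then show ?case
    using emb_1 by (simp add: reach_def one_quat_def)
next
  case (Suc n)
  have "Quat (cos \<theta>) 0 (sin \<theta>) 0 * Quat (cos (n * \<theta>)) 0 (sin (n * \<theta>)) 0 = Quat (cos (Suc n * \<theta>)) 0 (sin (Suc n * \<theta>)) 0"
    by (simp add: quat_eq_iff quat_sel_arith cos_add sin_add distrib_right algebra_simps)
  then show ?case
    using reach_mult[OF reach_rotation_Z[OF assms] Suc] by (simp flip: emb_mult)
qed

lemma SU2_reachable: "\<exists>n. \<forall>g\<in>SU2. reach n g"
proof -
  define \<beta> where "\<beta> = arcsin s"
  have s1: "s \<le> 1"
    by (simp add: s_def)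
  have \<beta>: "0 < \<beta>" "\<beta> \<le> pi / 2" "sin \<beta> = s"
    using s_pos s1 arcsin_less_arcsin[of 0 s] arcsin_bounded[of s] by (auto simp: \<beta>_def)
  \<comment> \<open>Every \<theta> below 2\<pi> divided by \<open>N\<close> is at most \<beta>, so
    the number of letters does not depend on \<open>g\<close>.\<close>
  obtain N :: nat where N: "2 * pi / \<beta> < real N"
    using reals_Archimedean2 by blast
  then have "N > 0"
    using \<beta> by (cases "N = 0") (auto simp: field_simps)
  have "reach (1 + 3 * N + 1) g" if "g \<in> SU2" for g
  proof -
    obtain q where "g = emb q"
      using surj_emb by (metis surjD)
    then obtain a b d e where g: "g = emb (Quat a b d e)"
      by (metis quat.exhaust)
    obtain r1 \<mu> where r1: "a = r1 * cos \<mu>" "b = r1 * sin \<mu>"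
      using polar_Ex by blast
    obtain r2 \<nu> where r2: "d = r2 * cos \<nu>" "e = r2 * sin \<nu>"
      using polar_Ex by blast
    have "a * a + b * b + d * d + e * e = 1"
      using that unfolding g SU2_def by (simp add: norm_emb norm_Quat)
    then have "r1\<^sup>2 + r2\<^sup>2 = 1"
      unfolding r1 r2 using sin_cos_squared_add[of \<mu>] sin_cos_squared_add[of \<nu>] by algebra
    then obtain \<theta> where \<theta>: "0 \<le> \<theta>" "\<theta> < 2 * pi" "r1 = cos \<theta>" "r2 = sin \<theta>"
      by (metis sincos_total_2pi)
    define \<eta> where "\<eta> = \<theta> / N"
    have \<eta>: "N * \<eta> = \<theta>" "0 \<le> \<eta>"
      using \<open>N > 0\<close> \<theta> by (simp_all add: \<eta>_def)
    have "\<theta> < \<beta> * N"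
      using \<theta>(2) N \<beta>(1) by (simp add: field_simps)
    then have "\<eta> \<le> \<beta>"
      using \<open>N > 0\<close> by (simp add: \<eta>_def field_simps)
    then have sin: "0 \<le> sin \<eta>" "sin \<eta> \<le> s"
      using \<eta> \<beta> pi_gt_zero by (auto intro!: sin_ge_zero sin_monotone_2pi_le simp flip: \<beta>(3))
    \<comment> \<open>The outer factors shift the phase of the 1,X-plane by \<open>p + q\<close> and
      that of the Z,XZ-plane by \<open>p - q\<close>.\<close>
    define p q where "p = (\<mu> + \<nu>) / 2" and "q = (\<mu> - \<nu>) / 2"
    have pq: "\<mu> = p + q" "\<nu> = p - q"
      by (simp_all add: p_def q_def field_simps)
    have "Quat (cos p) (sin p) 0 0 * Quat (cos \<theta>) 0 (sin \<theta>) 0 * Quat (cos q) (sin q) 0 0 = Quat a b d e"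
      unfolding r1 r2 \<theta>(3,4) pq
      by (simp add: quat_eq_iff quat_sel_arith cos_add sin_add cos_diff sin_diff algebra_simps)
    then have "g = exp (p *\<^sub>R X) * emb (Quat (cos \<theta>) 0 (sin \<theta>) 0) * exp (q *\<^sub>R X)"
      by (simp add: g exp_X flip: emb_mult)
    then show ?thesis
      using reach_mult[OF reach_mult[OF reach_exp[of X p] reach_rotation_Z_power[OF sin, of N]] reach_exp[of X q]]
      by (simp add: \<eta>)
  qed
  then show ?thesis
    by blast
qed

section \<open>Existence of n-optimal words\<close>

text \<open>Removing full periods keeps the value and cannot raise the cost, as the weights are
  positive; minimisation may thus run over a compact range of times.\<close>

lemma bounded_times:
  assumes "admissible {X, Y} w"
  shows "\<exists>w'. admissible {X, Y} w' \<and> length w' = length w \<and> word_val w' = word_val w \<and>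
    cost X \<kappa> w' \<le> cost X \<kappa> w \<and> (\<forall>t\<in>fst ` set w'. t \<le> 2 * pi)"
  using assms
proof (induction w)
  case (Cons l w)
  obtain t C where l: "l = (t, C)"
    by force
  then obtain w' where w': "admissible {X, Y} w'" "length w' = length w" "word_val w' = word_val w"
      "cost X \<kappa> w' \<le> cost X \<kappa> w" "\<forall>t\<in>fst ` set w'. t \<le> 2 * pi" and t: "t \<ge> 0" and C: "C \<in> {X, Y}"
    using Cons by auto
  define k where "k = \<lfloor>t / (2 * pi)\<rfloor>"
  define t' where "t' = t - 2 * pi * of_int k"
  have "of_int k \<le> t / (2 * pi)" "t / (2 * pi) \<le> of_int k + 1" "0 \<le> k"
    using t by (simp_all add: k_def real_of_int_floor_add_one_ge)
  then have t': "0 \<le> t'" "t' \<le> 2 * pi" "t' \<le> t"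
    by (simp_all add: t'_def field_simps)
  have val: "exp (t' *\<^sub>R C) = exp (t *\<^sub>R C)"
    using exp_control_periodic[OF C, of t' k] by (simp add: t'_def)
  have "(if C = X then 1 else \<kappa>) * t' \<le> (if C = X then 1 else \<kappa>) * t"
    using t' \<kappa>_pos by (intro mult_left_mono) auto
  with w' t' val C show ?case
    by (intro exI[of _ "(t', C) # w'"]) (auto simp: l)
qed simp

lemma cost_le_length:
  assumes "admissible {X, Y} w" "\<forall>t\<in>fst ` set w. t \<le> B" "B \<ge> 0"
  shows "cost X \<kappa> w \<le> B * length w"
  using assms
proof (induction w)
  case (Cons l w)
  obtain t C where l: "l = (t, C)"
    by force
  have "(if C = X then 1 else \<kappa>) * t \<le> 1 * t"
    using Cons.prems \<kappa>_less_1 by (intro mult_right_mono) (auto simp: l)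
  then show ?case
    using Cons by (auto simp: l algebra_simps)
qed simp

text \<open>Passing to pairs of value and cost avoids a topology on words: prepending a letter acts
  on them continuously, so each set is a finite union of continuous images of compact sets.\<close>

lemma compact_values:
  "compact {(word_val w, cost X \<kappa> w) |w. admissible {X, Y} w \<and> length w = n \<and> (\<forall>t\<in>fst ` set w. t \<le> 2 * pi)}"
    (is "compact (?K n)")
proof (induction n)
  case 0
  have "?K 0 = {(1, 0)}"
    by auto
  then show ?case
    by simp
next
  case (Suc n)
  define f where "f C = (\<lambda>(t, q, c). (exp (t *\<^sub>R C) * q, (if C = X then 1 else \<kappa>) * t + c))" for C
  have "compact (f C ` ({0..2 * pi} \<times> ?K n))" if "C \<in> {X, Y}" for C
  proof (rule compact_continuous_image)
    show "continuous_on ({0..2 * pi} \<times> ?K n) (f C)"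
      unfolding f_def case_prod_unfold exp_control[OF that] by (intro continuous_intros)
  qed (intro compact_Times compact_Icc Suc)
  then have "compact (f X ` ({0..2 * pi} \<times> ?K n) \<union> f Y ` ({0..2 * pi} \<times> ?K n))"
    by (intro compact_Un) auto
  also have "f X ` ({0..2 * pi} \<times> ?K n) \<union> f Y ` ({0..2 * pi} \<times> ?K n) = ?K (Suc n)"
  proof (intro set_eqI iffI)
    fix z assume "z \<in> f X ` ({0..2 * pi} \<times> ?K n) \<union> f Y ` ({0..2 * pi} \<times> ?K n)"
    then obtain C p where C: "C \<in> {X, Y}" "z = f C p" and "p \<in> {0..2 * pi} \<times> ?K n"
      by blast
    then obtain t w where "p = (t, word_val w, cost X \<kappa> w)" "0 \<le> t" "t \<le> 2 * pi"
      "admissible {X, Y} w" "length w = n" "\<forall>t\<in>fst ` set w. t \<le> 2 * pi"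
      by auto
    with C show "z \<in> ?K (Suc n)"
      by (intro CollectI exI[of _ "(t, C) # w"]) (auto simp: f_def)
  next
    fix z assume "z \<in> ?K (Suc n)"
    then obtain w where w: "z = (word_val w, cost X \<kappa> w)" "admissible {X, Y} w" "length w = Suc n"
        "\<forall>t\<in>fst ` set w. t \<le> 2 * pi"
      by auto
    then obtain t C v where "w = (t, C) # v"
      by (metis length_Suc_conv surj_pair)
    with w have "z = f C (t, word_val v, cost X \<kappa> v)" "(t, word_val v, cost X \<kappa> v) \<in> {0..2 * pi} \<times> ?K n" "C \<in> {X, Y}"
      by (auto simp: f_def)
    then show "z \<in> f X ` ({0..2 * pi} \<times> ?K n) \<union> f Y ` ({0..2 * pi} \<times> ?K n)"
      by blast
  qed
  finally show ?case .
qed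

lemma n_optimal_exists:
  assumes "reach n g"
  shows "\<exists>w. n_optimal X Y \<kappa> n w \<and> word_val w = g \<and> cost X \<kappa> w \<le> 2 * pi * n"
proof -
  define K where "K = {(word_val w, cost X \<kappa> w) |w. admissible {X, Y} w \<and> length w = n \<and> (\<forall>t\<in>fst ` set w. t \<le> 2 * pi)}"
  have K: "\<exists>c'\<le>cost X \<kappa> w. (g, c') \<in> K" if w: "admissible {X, Y} w" "length w = n" "word_val w = g" for w
  proof -
    obtain w' where "admissible {X, Y} w'" "length w' = length w" "word_val w' = word_val w"
        "cost X \<kappa> w' \<le> cost X \<kappa> w" "\<forall>t\<in>fst ` set w'. t \<le> 2 * pi"
      using bounded_times[OF w(1)] by blast
    then show ?thesis
      using w(2,3) unfolding K_def by (intro exI[of _ "cost X \<kappa> w'"]) auto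
  qed
  \<comment> \<open>The fibre over \<open>g\<close> is a closed part of \<open>K\<close>, so its
    cost coordinate attains a minimum.\<close>
  have "compact (K \<inter> {g} \<times> UNIV)"
    using compact_values[of n] by (intro compact_Int_closed closed_Times) (auto simp: K_def)
  moreover have "K \<inter> {g} \<times> UNIV \<noteq> {}"
    using assms K unfolding reach_def by blast
  ultimately obtain z where z: "z \<in> K \<inter> {g} \<times> UNIV" "\<And>z'. z' \<in> K \<inter> {g} \<times> UNIV \<Longrightarrow> snd z \<le> snd z'"
    using continuous_attains_inf[of "K \<inter> {g} \<times> UNIV" snd] continuous_on_snd[OF continuous_on_id] by blast
  then obtain w where w: "z = (word_val w, cost X \<kappa> w)" "admissible {X, Y} w" "length w = n"
      "\<forall>t\<in>fst ` set w. t \<le> 2 * pi"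
    unfolding K_def by auto
  have g: "word_val w = g"
    using z(1) w(1) by auto
  have "n_optimal X Y \<kappa> n w"
    unfolding n_optimal_def
  proof (intro conjI allI impI w(2,3))
    fix w' assume "admissible {X, Y} w' \<and> length w' = n \<and> word_val w' = word_val w"
    then obtain c' where "c' \<le> cost X \<kappa> w'" "(g, c') \<in> K"
      using K g by metis
    then show "cost X \<kappa> w \<le> cost X \<kappa> w'"
      using z(2)[of "(g, c')"] w(1) by auto
  qed
  then show ?thesis
    using g cost_le_length[OF w(2,4)] w(3) by auto
qed

section \<open>Bounded length\<close>

text \<open>Equal cost is allowed, so that a word of least length among the cheapest ones has no
  \<open>shorter\<close> competitor.\<close>

definition shorter where
  "shorter w' w \<longleftrightarrow> admissible {X, Y} w' \<and> word_val w' = word_val w \<and> cost X \<kappa> w' \<le> cost X \<kappa> w \<and> length w' < length w"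

lemma shorter_if_not_reduced:
  assumes "admissible {X, Y} w" "\<not> reduced_word w"
  shows "\<exists>w'. shorter w' w"
proof -
  consider i where "i < length w" "\<not> 0 < fst (w ! i)" | i where "i + 1 < length w" "snd (w ! i) = snd (w ! (i + 1))"
    using assms(2) by (auto simp: reduced_word_nth)
  then show ?thesis
  proof cases
    case 1
    obtain t C where l: "w ! i = (t, C)"
      by force
    obtain u v where w: "w = u @ (t, C) # v"
      using decompose_nth1[OF 1(1)] l by metis
    have "t = 0"
      using assms(1) 1(2) l by (simp add: w)
    then show ?thesis
      using assms(1) by (intro exI[of _ "u @ v"]) (simp add: shorter_def w)
  next
    case 2
    obtain t C t' where l: "w ! i = (t, C)" "w ! (i + 1) = (t', C)"
      using 2(2) by (metis prod.collapse)
    obtain u v where w: "w = u @ (t, C) # (t', C) # v"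
      using decompose_nth2[OF 2(1)] l by metis
    have "exp ((t + t') *\<^sub>R C) = exp (t *\<^sub>R C) * exp (t' *\<^sub>R C)"
      unfolding scaleR_add_left by (rule exp_add_commuting) simp
    then show ?thesis
      using assms(1) by (intro exI[of _ "u @ (t + t', C) # v"]) (simp add: shorter_def w mult.assoc distrib_left)
  qed
qed

text \<open>Here \<open>exp(tY)\<close> is 1 or -1, hence central, and the two neighbouring letters
  \<open>X\<close> merge.\<close>

lemma shorter_if_sin_eq_0:
  assumes "admissible {X, Y} (u @ (a, X) # (t, Y) # (b, X) # v)" "sin t = 0"
  shows "\<exists>w'. shorter w' (u @ (a, X) # (t, Y) # (b, X) # v)"
proof -
  have "exp ((a + b) *\<^sub>R X) = exp (a *\<^sub>R X) * exp (b *\<^sub>R X)"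
    unfolding scaleR_add_left by (rule exp_add_commuting) simp
  then show ?thesis
    using assms(1) exp_control[of Y t] assms(2)
    by (intro exI[of _ "u @ (a + b, X) # (t, Y) # v"]) (simp add: shorter_def mult.assoc)
qed

lemma controls_alternate:
  assumes "admissible {X, Y} w" "reduced_word w" "i + 1 < length w"
  shows "snd (w ! i) = X \<and> snd (w ! (i + 1)) = Y \<or> snd (w ! i) = Y \<and> snd (w ! (i + 1)) = X"
proof -
  have "snd (w ! j) \<in> {X, Y}" if "j < length w" for j
    using assms(1) nth_mem[OF that] by (auto simp: admissible_def)
  from this[of i] this[of "i + 1"] assms(2,3) show ?thesis
    unfolding reduced_word_nth by auto
qed

lemma letter_eq: "snd (w ! i) = C \<Longrightarrow> w ! i = (fst (w ! i), C)"
  by (metis prod.collapse)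

lemma middle_X_sin_double:
  assumes opt: "n_optimal X Y \<kappa> n w" and red: "reduced_word w"
    and Ysin: "\<And>i. 1 \<le> i \<Longrightarrow> i + 1 < n \<Longrightarrow> snd (w ! i) = Y \<Longrightarrow> sin (fst (w ! i)) \<noteq> 0"
    and i: "1 \<le> i" "i + 1 < n" "snd (w ! i) = X" and n: "4 \<le> n"
  shows "sin (2 * fst (w ! i)) = 0"
proof -
  have adm: "admissible {X, Y} w" and len: "length w = n"
    using opt by (auto simp: n_optimal_def)
  have pos: "0 < fst (w ! j)" if "j < n" for j
    using red that len by (simp add: reduced_word_nth)
  note alt = controls_alternate[OF adm red]
  \<comment> \<open>With at least four letters, a middle letter has two letters after it or two
    before it; the window is YXYX or XYXY accordingly, and its inner \<open>Y\<close> is again a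
    middle letter.\<close>
  consider "i + 2 < n" | "2 \<le> i"
    using i n by linarith
  then show ?thesis
  proof cases
    case 1
    define j where "j = i - 1"
    have ij: "i = j + 1" "j + 3 < n"
      using i 1 by (auto simp: j_def)
    have c: "snd (w ! j) = Y" "snd (w ! (j + 2)) = Y" "snd (w ! (j + 3)) = X"
      using alt[of j] alt[of "j + 1"] alt[of "j + 2"] ij i X_neq_Y len by (auto simp: numeral_3_eq_3)
    have w: "w = take j w @ [(fst (w ! j), Y), (fst (w ! i), X), (fst (w ! (j + 2)), Y), (fst (w ! (j + 3)), X)] @ drop (j + 4) w"
      using decompose_nth4[of j w] letter_eq[OF c(1)] letter_eq[OF c(2)] letter_eq[OF c(3)] letter_eq[OF i(3)] ij len
      by metis
    have "n_optimal X Y \<kappa> n (take j w @ [(fst (w ! j), Y), (fst (w ! i), X), (fst (w ! (j + 2)), Y), (fst (w ! (j + 3)), X)] @ drop (j + 4) w)"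
      using opt w by simp
    from middle_X_in_YXYX[OF n_optimal_window[OF this]] show ?thesis
      using pos Ysin[of "j + 2"] ij c i by auto
  next
    case 2
    define j where "j = i - 2"
    have ij: "i = j + 2" "j + 3 < n"
      using i 2 by (auto simp: j_def)
    have c: "snd (w ! j) = X" "snd (w ! (j + 1)) = Y" "snd (w ! (j + 3)) = Y"
      using alt[of j] alt[of "j + 1"] alt[of "j + 2"] ij i X_neq_Y len by (auto simp: numeral_3_eq_3)
    have w: "w = take j w @ [(fst (w ! j), X), (fst (w ! (j + 1)), Y), (fst (w ! i), X), (fst (w ! (j + 3)), Y)] @ drop (j + 4) w"
      using decompose_nth4[of j w] letter_eq[OF c(1)] letter_eq[OF c(2)] letter_eq[OF c(3)] letter_eq[OF i(3)] ij len
      by metis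
    have "n_optimal X Y \<kappa> n (take j w @ [(fst (w ! j), X), (fst (w ! (j + 1)), Y), (fst (w ! i), X), (fst (w ! (j + 3)), Y)] @ drop (j + 4) w)"
      using opt w by simp
    from middle_X_in_XYXY[OF n_optimal_window[OF this]] show ?thesis
      using pos Ysin[of "j + 1"] ij c i by auto
  qed
qed

text \<open>Letters of time 0 are admissible, free and have value 1, so n-optimal words also compete
  with all words of at most \<open>n\<close> letters.\<close>

lemma pad:
  assumes "admissible {X, Y} w" "length w \<le> n"
  obtains w' where "admissible {X, Y} w'" "length w' = n" "word_val w' = word_val w" "cost X \<kappa> w' = cost X \<kappa> w"
proof -
  have "word_val (replicate k (0, X)) = 1 \<and> cost X \<kappa> (replicate k (0, X)) = 0 \<and> admissible {X, Y} (replicate k (0, X))" for k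
    by (induction k) auto
  then show thesis
    using assms by (intro that[of "w @ replicate (n - length w) (0, X)"]) auto
qed

lemma middle_Y_sin_nonzero:
  assumes "admissible {X, Y} w" "reduced_word w" "\<nexists>w'. shorter w' w"
    and i: "1 \<le> i" "i + 1 < length w" "snd (w ! i) = Y"
  shows "sin (fst (w ! i)) \<noteq> 0"
proof
  assume "sin (fst (w ! i)) = 0"
  define j where "j = i - 1"
  have j: "i = j + 1" "j + 2 < length w"
    using i by (auto simp: j_def)
  have c: "snd (w ! j) = X" "snd (w ! (j + 2)) = X"
    using controls_alternate[OF assms(1,2), of j] controls_alternate[OF assms(1,2), of "j + 1"] i j X_neq_Y by auto
  have "w = take j w @ (fst (w ! j), X) # (fst (w ! i), Y) # (fst (w ! (j + 2)), X) # drop (j + 3) w"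
    using decompose_nth3[OF j(2)] letter_eq[OF c(1)] letter_eq[OF c(2)] letter_eq[OF i(3)] j(1) by metis
  then show False
    using shorter_if_sin_eq_0[OF _ \<open>sin (fst (w ! i)) = 0\<close>] assms(1,3) by metis
qed

text \<open>Of two consecutive middle letters one is \<open>X\<close>, and its time is a positive
  zero of \<open>sin (2 * t)\<close>, hence at least \<pi>/2.\<close>

lemma cost_ge_length:
  assumes opt: "n_optimal X Y \<kappa> n w" and short: "\<nexists>w'. shorter w' w" and n: "4 \<le> n"
  shows "pi / 2 * real ((n - 2) div 2) \<le> cost X \<kappa> w"
proof -
  have adm: "admissible {X, Y} w" and len: "length w = n"
    using opt by (auto simp: n_optimal_def)
  have red: "reduced_word w"
    using shorter_if_not_reduced adm short by blast
  define c where "c = (\<lambda>(t, C). (if C = X then 1 else \<kappa>) * (t::real))"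
  have c0: "0 \<le> c l" if "l \<in> set w" for l
    using adm that \<kappa>_pos by (auto simp: c_def admissible_def)
  have cX: "pi / 2 \<le> c (w ! i)" if "1 \<le> i" "i + 1 < n" "snd (w ! i) = X" for i
  proof -
    have "sin (2 * fst (w ! i)) = 0"
      using middle_Y_sin_nonzero[OF adm red short] len
      by (intro middle_X_sin_double[OF opt red _ that n]) simp
    moreover have "0 < fst (w ! i)"
      using red that len by (simp add: reduced_word_nth)
    ultimately show ?thesis
      using pi_half_le_of_sin_double_eq_0 that(3) by (simp add: c_def split_beta)
  qed
  obtain a v b where w: "w = a # v @ [b]" and v: "length v = n - 2"
  proof -
    have "w \<noteq> []" "tl w \<noteq> []"
      using n len by (auto simp flip: length_greater_0_conv)
    then show thesis
      using len by (intro that[of "hd w" "butlast (tl w)" "last (tl w)"]) auto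
  qed
  have nth: "v ! i = w ! (i + 1)" if "i < length v" for i
    using that by (simp add: w nth_append)
  have "pi / 2 * real (length (map c v) div 2) \<le> sum_list (map c v)"
  proof (rule sum_list_pairs_ge)
    fix i assume i: "i + 1 < length (map c v)"
    then have "snd (w ! (i + 1)) = X \<or> snd (w ! (i + 2)) = X"
      using controls_alternate[OF adm red, of "i + 1"] len v by auto
    moreover have "0 \<le> c (w ! (i + 1))" "0 \<le> c (w ! (i + 2))"
      using i v len c0 by auto
    moreover have "i + 1 + 1 < n" "i + 2 + 1 < n"
      using i v by auto
    ultimately have "pi / 2 \<le> c (w ! (i + 1)) + c (w ! (i + 2))"
      using cX[of "i + 1"] cX[of "i + 2"] by linarith
    then show "pi / 2 \<le> map c v ! i + map c v ! (i + 1)"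
      using i nth[of i] nth[of "i + 1"] by simp
  qed (use c0 in \<open>auto simp: w\<close>)
  also have "\<dots> \<le> cost X \<kappa> w"
    using c0[of a] c0[of b] by (simp add: w cost_def c_def)
  finally show ?thesis
    by (simp add: v)
qed

text \<open>A fixed number \<open>n0\<close> of letters reaches every element at cost at most
  \<open>2 * pi * n0\<close>, whereas long optimal words that cannot be shortened cost more.\<close>

lemma uniformly_bounded_length:
  "\<exists>N. \<forall>w. admissible {X, Y} w \<longrightarrow> (\<exists>w'. admissible {X, Y} w' \<and> word_val w' = word_val w \<and>
    cost X \<kappa> w' \<le> cost X \<kappa> w \<and> length w' \<le> N)"
proof -
  obtain n0 where n0: "\<And>g. g \<in> SU2 \<Longrightarrow> reach n0 g"
    using SU2_reachable by blast
  have "\<exists>w'. admissible {X, Y} w' \<and> word_val w' = word_val w \<and> cost X \<kappa> w' \<le> cost X \<kappa> w \<and> length w' \<le> 8 * n0 + 3"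
    if w: "admissible {X, Y} w" for w
  proof -
    define n where "n = max (length w) n0"
    have "word_val w \<in> SU2"
      using norm_word_val[OF w] by (simp add: SU2_def)
    then obtain w0 where w0: "n_optimal X Y \<kappa> n0 w0" "word_val w0 = word_val w" "cost X \<kappa> w0 \<le> 2 * pi * n0"
      using n_optimal_exists[OF n0] by blast
    have "reach n (word_val w)"
      using pad[OF w, of n] unfolding reach_def n_def by (metis max.cobounded1)
    then obtain w1 where w1: "n_optimal X Y \<kappa> n w1" "word_val w1 = word_val w"
      using n_optimal_exists by blast
    have min: "cost X \<kappa> w1 \<le> cost X \<kappa> v" if "admissible {X, Y} v" "length v \<le> n" "word_val v = word_val w" for v
      using pad[OF that(1,2)] w1 that(3) unfolding n_optimal_def by metis
    \<comment> \<open>A shortest word satisfying \<open>P\<close> cannot be shortened and is optimal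
      for its own length, so the lower cost bound applies to it.\<close>
    define P where "P v \<longleftrightarrow> admissible {X, Y} v \<and> word_val v = word_val w \<and> cost X \<kappa> v \<le> cost X \<kappa> w1 \<and> length v \<le> n" for v
    have "P w1"
      using w1 by (simp add: P_def n_optimal_def)
    then obtain v where v: "P v" "\<And>v'. P v' \<Longrightarrow> length v \<le> length v'"
      using ex_has_least_nat[of P w1 length] by blast
    have "\<nexists>v'. shorter v' v"
    proof
      assume "\<exists>v'. shorter v' v"
      then obtain v' where "shorter v' v" by blast
      then have "P v'" "length v' < length v"
        using v(1) by (auto simp: P_def shorter_def)
      then show False
        using v(2) by fastforce
    qed
    moreover have "n_optimal X Y \<kappa> (length v) v"
      unfolding n_optimal_def using v(1) min by (auto simp: P_def intro: order_trans)
    ultimately have *: "4 \<le> length v \<Longrightarrow> pi / 2 * real ((length v - 2) div 2) \<le> cost X \<kappa> v"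
      using cost_ge_length by blast
    have cost: "cost X \<kappa> v \<le> 2 * pi * n0"
      using v(1) w0 min[of w0] by (auto simp: P_def n_optimal_def n_def)
    have "(length v - 2) div 2 \<le> 4 * n0" if "4 \<le> length v"
    proof -
      have "pi / 2 * real ((length v - 2) div 2) \<le> pi / 2 * real (4 * n0)"
        using order_trans[OF *[OF that] cost] by (simp add: mult.assoc)
      then show ?thesis
        by (simp only: mult_le_cancel_left_pos pi_half_gt_zero of_nat_le_iff)
    qed
    \<comment> \<open>The factor 4 is \<open>2 * pi\<close> over \<open>pi / 2\<close>; doubling,
      the two end letters and rounding in \<open>div\<close> give the constant, which also covers
      fewer than four letters.\<close>
    then have "length v \<le> 8 * n0 + 3"
      by linarith
    then show ?thesis
      using v(1) min[OF w] by (intro exI[of _ v]) (auto simp: P_def n_def)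
  qed
  then show ?thesis
    by blast
qed

definition glob_opt where
  "glob_opt w \<longleftrightarrow> admissible {X, Y} w \<and>
    (\<forall>w'. admissible {X, Y} w' \<and> word_val w' = word_val w \<longrightarrow> cost X \<kappa> w \<le> cost X \<kappa> w')"

text \<open>By the length bound every competitor is matched at no higher cost by a word of length
  \<open>max N n0\<close>, so optimality at that length is global.\<close>

lemma glob_opt_exists:
  assumes "g \<in> SU2"
  shows "\<exists>w. glob_opt w \<and> word_val w = g"
proof -
  obtain n0 where "reach n0 g"
    using SU2_reachable assms by blast
  then obtain w0 where w0: "admissible {X, Y} w0" "length w0 = n0" "word_val w0 = g"
    by (auto simp: reach_def)
  obtain N where N: "\<And>w. admissible {X, Y} w \<Longrightarrow> (\<exists>w'. admissible {X, Y} w' \<and> word_val w' = word_val w \<and>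
    cost X \<kappa> w' \<le> cost X \<kappa> w \<and> length w' \<le> N)"
    using uniformly_bounded_length by blast
  define n where "n = max N n0"
  have "reach n g"
    using pad[of w0 n] w0 unfolding reach_def n_def by (metis max.cobounded2)
  then obtain w where w: "n_optimal X Y \<kappa> n w" "word_val w = g"
    using n_optimal_exists by blast
  have "cost X \<kappa> w \<le> cost X \<kappa> w'" if w': "admissible {X, Y} w'" "word_val w' = word_val w" for w'
  proof -
    obtain v where v: "admissible {X, Y} v" "word_val v = word_val w'" "cost X \<kappa> v \<le> cost X \<kappa> w'" "length v \<le> n"
      using N[OF w'(1)] unfolding n_def by fastforce
    obtain v' where "admissible {X, Y} v'" "length v' = n" "word_val v' = word_val v" "cost X \<kappa> v' = cost X \<kappa> v"
      using pad[OF v(1,4)] by blast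
    then have "cost X \<kappa> w \<le> cost X \<kappa> v'"
      using w(1) v(2) w'(2) unfolding n_optimal_def by metis
    then show ?thesis
      using v(3) \<open>cost X \<kappa> v' = cost X \<kappa> v\<close> by simp
  qed
  then show ?thesis
    using w by (auto simp: glob_opt_def n_optimal_def)
qed

section \<open>Words of globally minimal cost\<close>

lemma glob_opt_replace:
  assumes "glob_opt (u @ v @ r)" "admissible {X, Y} v'" "word_val v' = word_val v"
  shows "cost X \<kappa> v \<le> cost X \<kappa> v'"
proof -
  have "cost X \<kappa> (u @ v @ r) \<le> cost X \<kappa> (u @ v' @ r)"
    using assms unfolding glob_opt_def by (auto simp del: cost_simps)
  then show ?thesis
    by simp
qed

lemma exp_control_diff_pi: "C \<in> {X, Y} \<Longrightarrow> exp ((t - pi) *\<^sub>R C) = - exp (t *\<^sub>R C)"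
  using exp_control_add_pi[of C "t - pi"] by simp

lemma exp_control_pi: "C \<in> {X, Y} \<Longrightarrow> exp (pi *\<^sub>R C) = -1"
  using exp_control_add_pi[of C 0] by simp

text \<open>Replacing a portion \<pi> of \<open>X\<close> by \<open>exp(\<pi>Y)\<close>, which is
  the same element -1, saves \<open>(1 - \<kappa>) * pi\<close>.\<close>

lemma glob_opt_X_less_pi:
  assumes "glob_opt w" "i < length w" "snd (w ! i) = X"
  shows "fst (w ! i) < pi"
proof (rule ccontr)
  define t where "t = fst (w ! i)"
  assume "\<not> fst (w ! i) < pi"
  then have t: "pi \<le> t"
    by (simp add: t_def)
  have "w = take i w @ [(t, X)] @ drop (i + 1) w"
    using decompose_nth1[OF assms(2)] letter_eq[OF assms(3)] by (simp add: t_def)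
  then have "glob_opt (take i w @ [(t, X)] @ drop (i + 1) w)"
    using assms(1) by simp
  then have "cost X \<kappa> [(t, X)] \<le> cost X \<kappa> [(t - pi, X), (pi, Y)]"
    by (rule glob_opt_replace) (use t in \<open>simp_all add: exp_control_diff_pi exp_control_pi\<close>)
  then have "pi * (1 - \<kappa>) \<le> 0"
    using X_neq_Y by (simp add: algebra_simps)
  then show False
    using mult_pos_pos[OF pi_gt_zero, of "1 - \<kappa>"] \<kappa>_less_1 by linarith
qed

text \<open>Removing \<pi> from both letters changes the value by two signs, which cancel, and saves
  cost.\<close>

lemma glob_opt_one_Y_ge_pi:
  assumes "glob_opt w" and ij: "i < j" "j < length w" and Y: "snd (w ! i) = Y" "snd (w ! j) = Y"
    and t: "pi \<le> fst (w ! i)" "pi \<le> fst (w ! j)"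
  shows False
proof -
  define t t' where "t = fst (w ! i)" and "t' = fst (w ! j)"
  define v where "v = drop (i + 1) (take j w)"
  have "take j w = take i w @ (t, Y) # v"
    using decompose_nth1[of i "take j w"] ij letter_eq[OF Y(1)] by (simp add: t_def v_def min_def)
  then have w: "w = take i w @ ((t, Y) # v @ [(t', Y)]) @ drop (j + 1) w"
    using decompose_nth1[OF ij(2)] letter_eq[OF Y(2)] by (simp add: t'_def)
  then have opt: "glob_opt (take i w @ ((t, Y) # v @ [(t', Y)]) @ drop (j + 1) w)"
    using assms(1) by simp
  then have "admissible {X, Y} v"
    by (simp add: glob_opt_def)
  then have "cost X \<kappa> ((t, Y) # v @ [(t', Y)]) \<le> cost X \<kappa> ((t - pi, Y) # v @ [(t' - pi, Y)])"
    using t by (intro glob_opt_replace[OF opt]) (simp_all add: exp_control_diff_pi t_def t'_def)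
  then have "\<kappa> * pi \<le> 0"
    using X_neq_Y by (simp add: algebra_simps)
  then show False
    using mult_pos_pos[OF \<kappa>_pos pi_gt_zero] by linarith
qed

lemma glob_opt_n_optimal: "glob_opt w \<Longrightarrow> n_optimal X Y \<kappa> (length w) w"
  by (auto simp: glob_opt_def n_optimal_def)

text \<open>Both neighbours are letters \<open>X\<close> of positive time; a small time
  \<open>d\<close> is split off each, and the resulting inner word XYX is replaced by the cheaper
  YXY. The length grows, so global rather than n-optimality is used.\<close>

lemma glob_opt_Y_ge_pi_half:
  assumes opt: "glob_opt w" and red: "reduced_word w"
    and i: "1 \<le> i" "i + 1 < length w" "snd (w ! i) = Y"
  shows "pi / 2 \<le> fst (w ! i)"
proof (rule ccontr)
  define t where "t = fst (w ! i)"
  assume "\<not> pi / 2 \<le> fst (w ! i)"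
  then have t: "0 < t" "t < pi / 2"
    using red i by (auto simp: t_def reduced_word_nth)
  define j where "j = i - 1"
  have j: "i = j + 1" "j + 2 < length w"
    using i by (auto simp: j_def)
  have adm: "admissible {X, Y} w"
    using opt by (simp add: glob_opt_def)
  have c: "snd (w ! j) = X" "snd (w ! (j + 2)) = X"
    using controls_alternate[OF adm red, of j] controls_alternate[OF adm red, of "j + 1"] i j X_neq_Y by auto
  define a b where "a = fst (w ! j)" and "b = fst (w ! (j + 2))"
  have ab: "0 < a" "0 < b"
    using red j by (auto simp: a_def b_def reduced_word_nth)
  have "w = take j w @ [(a, X), (t, Y), (b, X)] @ drop (j + 3) w"
    using decompose_nth3[OF j(2)] letter_eq[OF c(1)] letter_eq[OF c(2)] letter_eq[OF i(3)] j(1)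
    by (simp add: a_def b_def t_def)
  then have opt': "glob_opt (take j w @ [(a, X), (t, Y), (b, X)] @ drop (j + 3) w)"
    using opt by simp
  obtain d e \<sigma> where d: "0 < d" "d < min a b" "0 < e" "0 < \<sigma>"
    and eq: "exp (d *\<^sub>R X) * exp (t *\<^sub>R Y) * exp (d *\<^sub>R X) = exp (\<sigma> *\<^sub>R Y) * exp (e *\<^sub>R X) * exp (\<sigma> *\<^sub>R Y)"
    and cost: "e + 2 * \<kappa> * \<sigma> < 2 * d + \<kappa> * t"
    using short_Y_between_X_improvable[OF t, of "min a b"] ab by auto
  have add: "exp ((p + q) *\<^sub>R X) = exp (p *\<^sub>R X) * exp (q *\<^sub>R X)" for p q
    unfolding scaleR_add_left by (rule exp_add_commuting) simp
  have "word_val [(a - d, X), (\<sigma>, Y), (e, X), (\<sigma>, Y), (b - d, X)]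
      = exp ((a - d) *\<^sub>R X) * (exp (\<sigma> *\<^sub>R Y) * exp (e *\<^sub>R X) * exp (\<sigma> *\<^sub>R Y)) * exp ((b - d) *\<^sub>R X)"
    by (simp add: mult.assoc)
  also have "\<dots> = word_val [(a, X), (t, Y), (b, X)]"
    unfolding eq[symmetric] using add[of "a - d" d] add[of d "b - d"] by (simp add: mult.assoc)
  finally have "cost X \<kappa> [(a, X), (t, Y), (b, X)] \<le> cost X \<kappa> [(a - d, X), (\<sigma>, Y), (e, X), (\<sigma>, Y), (b - d, X)]"
    using d by (intro glob_opt_replace[OF opt']) auto
  then show False
    using cost X_neq_Y by (simp add: algebra_simps)
qed

lemma glob_opt_structure:
  assumes opt: "glob_opt w" and red: "reduced_word w"
    and Ypi: "\<And>i. 1 \<le> i \<Longrightarrow> i + 1 < length w \<Longrightarrow> snd (w ! i) = Y \<Longrightarrow> fst (w ! i) < pi"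
  shows "pi_condition Y w" "2 \<le> p \<Longrightarrow> p + 3 \<le> length w \<Longrightarrow> time w p = time w (p + 2)"
    "middle w i \<Longrightarrow> control w i = Y \<Longrightarrow> pi / 2 \<le> time w i \<and> time w i < pi"
    "4 \<le> length w \<Longrightarrow> middle w i \<Longrightarrow> control w i = X \<Longrightarrow> time w i = pi / 2"
proof -
  have adm: "admissible {X, Y} w"
    using opt by (simp add: glob_opt_def)
  have XY: "snd (w ! i) \<in> {X, Y}" if "i < length w" for i
    using adm nth_mem[OF that] by (auto simp: admissible_def)
  have pos: "0 < fst (w ! i)" if "i < length w" for i
    using red that by (simp add: reduced_word_nth)
  have geY: "snd (w ! i) = Y" if "i < length w" "pi \<le> fst (w ! i)" for i
    using glob_opt_X_less_pi[OF opt, of i] XY[of i] that by force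
  have one: "i = j" if "i < length w" "j < length w" "pi \<le> fst (w ! i)" "pi \<le> fst (w ! j)" for i j
    using glob_opt_one_Y_ge_pi[OF opt, of i j] glob_opt_one_Y_ge_pi[OF opt, of j i] geY that
    by (metis linorder_neqE_nat)
  have mid: "1 \<le> i - 1" "i - 1 + 1 < length w" if "middle w i" for i
    using that by (auto simp: middle_def)
  show "pi_condition Y w"
    unfolding pi_condition_def
  proof (intro conjI ballI impI)
    fix i j assume ij: "i \<in> {1..length w}" "j \<in> {1..length w}" "pi \<le> time w i \<and> pi \<le> time w j"
    then have "i - 1 = j - 1"
      by (intro one) (auto simp: time_def)
    then show "i = j"
      using ij by auto
  next
    fix i assume i: "i \<in> {1..length w}" "pi \<le> time w i"
    then show Y: "control w i = Y"
      using geY[of "i - 1"] by (auto simp: time_def control_def)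
    show "\<not> middle w i"
      using Ypi[OF mid[of i]] i Y by (auto simp: time_def control_def)
  qed
  have sinY: "sin (fst (w ! i)) \<noteq> 0" if "1 \<le> i" "i + 1 < length w" "snd (w ! i) = Y" for i
    using sin_gt_zero[OF pos[of i] Ypi[OF that]] that by simp
  have midX: "fst (w ! i) = pi / 2" if "1 \<le> i" "i + 1 < length w" "snd (w ! i) = X" "4 \<le> length w" for i
    using that pos[of i] glob_opt_X_less_pi[OF opt, of i]
    by (intro eq_pi_half_of_sin_double_eq_0 middle_X_sin_double[OF glob_opt_n_optimal[OF opt] red sinY]) auto
  show "middle w i \<Longrightarrow> control w i = Y \<Longrightarrow> pi / 2 \<le> time w i \<and> time w i < pi"
    using glob_opt_Y_ge_pi_half[OF opt red mid] Ypi[OF mid] by (simp add: time_def control_def)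
  show "4 \<le> length w \<Longrightarrow> middle w i \<Longrightarrow> control w i = X \<Longrightarrow> time w i = pi / 2"
    using midX[OF mid] by (simp add: time_def control_def)
  assume p: "2 \<le> p" "p + 3 \<le> length w"
  \<comment> \<open>Positions \<open>p\<close> and \<open>p + 2\<close> counted from 1 become
    \<open>j + 1\<close> and \<open>j + 3\<close>, the second and fourth letters of a window of
    five.\<close>
  define j where "j = p - 2"
  have j: "p = j + 2" "j + 4 < length w"
    using p by (auto simp: j_def)
  note alt = controls_alternate[OF adm red]
  have "fst (w ! (j + 1)) = fst (w ! (j + 3))"
  proof (cases "snd (w ! (j + 1)) = X")
    case True
    then have "snd (w ! (j + 3)) = X"
      using alt[of "j + 1"] alt[of "j + 2"] j X_neq_Y by (auto simp: numeral_3_eq_3)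
    then show ?thesis
      using midX[of "j + 1"] midX[of "j + 3"] True j by auto
  next
    case False
    then have c: "snd (w ! j) = X" "snd (w ! (j + 1)) = Y" "snd (w ! (j + 2)) = X" "snd (w ! (j + 3)) = Y" "snd (w ! (j + 4)) = X"
      using alt[of j] alt[of "j + 1"] alt[of "j + 2"] alt[of "j + 3"] j X_neq_Y by (auto simp: eval_nat_numeral)
    define t u where "t = fst (w ! (j + 1))" and "u = fst (w ! (j + 3))"
    have "fst (w ! (j + 2)) = pi / 2"
      using midX[of "j + 2"] c j by auto
    then have m: "w ! (j + 2) = (pi / 2, X)"
      using letter_eq[OF c(3)] by metis
    have "w = take j w @ [(fst (w ! j), X), (t, Y), (pi / 2, X), (u, Y), (fst (w ! (j + 4)), X)] @ drop (j + 5) w"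
      using decompose_nth5[OF j(2)] letter_eq[OF c(1)] letter_eq[OF c(2)] letter_eq[OF c(4)] letter_eq[OF c(5)] m
      unfolding t_def u_def by metis
    then have "n_optimal X Y \<kappa> (length w) (take j w @ [(fst (w ! j), X), (t, Y), (pi / 2, X), (u, Y), (fst (w ! (j + 4)), X)] @ drop (j + 5) w)"
      using glob_opt_n_optimal[OF opt] by simp
    then have "sin (t - u) = 0"
      using middle_Y_in_XYXYX[OF n_optimal_window] pos sinY[of "j + 1"] sinY[of "j + 3"] c j by (auto simp: t_def u_def)
    moreover have "0 < t" "t < pi" "0 < u" "u < pi"
      using pos Ypi[of "j + 1"] Ypi[of "j + 3"] c j by (auto simp: t_def u_def)
    \<comment> \<open>Both times lie strictly between 0 and \<pi>, so equality modulo \<pi> is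
      equality.\<close>
    ultimately have "t = u"
      using sin_gt_zero[of "t - u"] sin_gt_zero[of "u - t"] sin_minus[of "t - u"] by (cases t u rule: linorder_cases) auto
    then show ?thesis
      by (simp add: t_def u_def)
  qed
  then show "time w p = time w (p + 2)"
    by (simp add: time_def j eval_nat_numeral)
qed

lemma glob_opt_middle_Y_less_pi_exists:
  assumes "g \<in> SU2"
  shows "\<exists>w. glob_opt w \<and> reduced_word w \<and> word_val w = g \<and>
    (\<forall>i. 1 \<le> i \<and> i + 1 < length w \<and> snd (w ! i) = Y \<longrightarrow> fst (w ! i) < pi)"
proof -
  \<comment> \<open>Least length among the globally optimal words forces reducedness and excludes
    middle letters \<open>Y\<close> of time exactly \<pi>.\<close>
  obtain w where w: "glob_opt w" "word_val w = g"
    and min: "\<And>w'. glob_opt w' \<Longrightarrow> word_val w' = g \<Longrightarrow> length w \<le> length w'"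
    using ex_has_least_nat[of "\<lambda>w. glob_opt w \<and> word_val w = g" _ length] glob_opt_exists[OF assms] by metis
  have adm: "admissible {X, Y} w"
    using w by (simp add: glob_opt_def)
  have glob_opt_if: "glob_opt w'" if "admissible {X, Y} w'" "word_val w' = g" "cost X \<kappa> w' \<le> cost X \<kappa> w" for w'
    using w that unfolding glob_opt_def by (metis order_trans)
  have short: "\<nexists>w'. shorter w' w"
    using min glob_opt_if w(2) unfolding shorter_def by (metis not_less)
  then have red: "reduced_word w"
    using shorter_if_not_reduced adm by blast
  show ?thesis
  proof (cases "\<exists>i. 1 \<le> i \<and> i + 1 < length w \<and> snd (w ! i) = Y \<and> pi \<le> fst (w ! i)")
    case False
    then show ?thesis
      using w red by (metis not_le)
  next
    case True
    then obtain i where i: "1 \<le> i" "i + 1 < length w" "snd (w ! i) = Y" "pi \<le> fst (w ! i)"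
      by blast
    define t where "t = fst (w ! i)"
    have "sin t \<noteq> 0"
      using middle_Y_sin_nonzero[OF adm red short] i by (simp add: t_def)
    \<comment> \<open>Strictness keeps the remaining time \<open>t - pi\<close> positive after the
      excess is moved, so the new word stays reduced.\<close>
    then have t: "pi < t"
      using i(4) by (cases "t = pi") (auto simp: t_def)
    define u where "u = take i w"
    have "w = u @ (t, Y) # drop (i + 1) w" "drop (i + 1) w \<noteq> []"
      using decompose_nth1[of i w] letter_eq[OF i(3)] i by (simp_all add: t_def u_def)
    then obtain v l where wv: "w = u @ (t, Y) # v @ [l]"
      by (metis append_butlast_last_id)
    obtain b C where l: "l = (b, C)"
      by force
    have C: "C \<in> {X, Y}" and b: "0 < b" and uv: "admissible {X, Y} u" "admissible {X, Y} v"
      using adm red by (auto simp: wv l reduced_word_iff)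
    \<comment> \<open>Since \<open>exp(\<pi>Y) = -1\<close> is central, the excess \<open>\<pi>\<close> can be moved to the end of the word,
      at the price of one more letter if the word ends in \<open>X\<close>.\<close>
    obtain w' where w': "glob_opt w'" "reduced_word w'" "word_val w' = g"
      and last: "w' \<noteq> []" "snd (last w') = Y" "pi \<le> fst (last w')"
    proof (cases "C = Y")
      case True
      define w' where "w' = u @ (t - pi, Y) # v @ [(b + pi, Y)]"
      have "glob_opt w'"
        using t b uv w(2) X_neq_Y by (intro glob_opt_if)
          (simp_all add: w'_def wv l True exp_control_diff_pi exp_control_add_pi distrib_left right_diff_distrib)
      moreover have "reduced_word w'"
        using red t add_pos_pos[OF b pi_gt_zero] unfolding reduced_word_iff by (auto simp: w'_def wv l True)
      ultimately show thesis
        using b t uv w(2) by (intro that[of w'])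
          (simp_all add: w'_def wv l True exp_control_diff_pi exp_control_add_pi)
    next
      case False
      define w' where "w' = u @ (t - pi, Y) # v @ [(b, X), (pi, Y)]"
      have X: "C = X"
        using C False by simp
      have "glob_opt w'"
        using t b uv w(2) X_neq_Y by (intro glob_opt_if)
          (simp_all add: w'_def wv l X exp_control_diff_pi exp_control_pi distrib_left right_diff_distrib)
      moreover have "reduced_word w'"
        using red t b X_neq_Y unfolding reduced_word_iff
        by (auto simp: w'_def wv l X distinct_adj_append_iff distinct_adj_Cons hd_append split: if_splits)
      ultimately show thesis
        using b t uv w(2) by (intro that[of w'])
          (simp_all add: w'_def wv l X exp_control_diff_pi exp_control_pi)
    qed
    \<comment> \<open>The last letter already has time at least \<pi>, and a globally optimal word
      has only one such letter \<open>Y\<close>.\<close>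
    have "fst (w' ! k) < pi" if "1 \<le> k" "k + 1 < length w'" "snd (w' ! k) = Y" for k
      using glob_opt_one_Y_ge_pi[OF w'(1), of k "length w' - 1"] that last by (force simp: last_conv_nth)
    then show ?thesis
      using w' by blast
  qed
qed

end

theorem theorem2p12:
  fixes X Y :: quat and \<alpha> \<kappa> :: real
  assumes "X \<in> su2" and "Y \<in> su2" and "norm X = 1" and "norm Y = 1"
    and "0 < \<alpha>" and "\<alpha> < pi" and "\<alpha> = vec_angle X Y"
    and "0 \<le> \<kappa>" and "\<kappa> \<le> 1"
    and "\<kappa> = cos \<alpha>" and "cos \<alpha> > 0"
  shows "\<forall>g\<in>SU2. \<exists>n w.
    n_optimal X Y \<kappa> n w \<and> reduced_word w \<and> word_val w = g \<and> cost X \<kappa> w = inf_cost X Y \<kappa> g \<and>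
    pi_condition Y w \<and>
    (\<forall>p. 2 \<le> p \<and> p + 3 \<le> n \<longrightarrow> time w p = time w (p + 2)) \<and>
    (\<forall>i. middle w i \<and> control w i = Y \<longrightarrow> pi / 2 \<le> time w i \<and> time w i < pi) \<and>
    (n \<ge> 4 \<longrightarrow> (\<forall>i. middle w i \<and> control w i = X \<longrightarrow> time w i = pi / 2))"
proof
  fix g assume g: "g \<in> SU2"
  \<comment> \<open>Cauchy-Schwarz places the inner product in the range where cos inverts
    arccos.\<close>
  have "\<bar>X \<bullet> Y\<bar> \<le> 1"
    using Cauchy_Schwarz_ineq2[of X Y] assms by simp
  then have inner: "X \<bullet> Y = \<kappa>"
    using assms by (simp add: vec_angle_def cos_arccos_abs)
  have "\<kappa> < 1"
    using cos_monotone_0_pi[of 0 \<alpha>] assms by simp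
  then interpret two_controls X Y \<kappa>
    using assms inner by unfold_locales auto
  obtain w where w: "glob_opt w" "reduced_word w" "word_val w = g"
    "\<And>i. 1 \<le> i \<Longrightarrow> i + 1 < length w \<Longrightarrow> snd (w ! i) = Y \<Longrightarrow> fst (w ! i) < pi"
    using glob_opt_middle_Y_less_pi_exists[OF g] by blast
  have "cost X \<kappa> w = inf_cost X Y \<kappa> g"
    unfolding inf_cost_def using w(1,3) by (intro cInf_eq_minimum[symmetric]) (auto simp: glob_opt_def)
  then show "\<exists>n w.
    n_optimal X Y \<kappa> n w \<and> reduced_word w \<and> word_val w = g \<and> cost X \<kappa> w = inf_cost X Y \<kappa> g \<and>
    pi_condition Y w \<and>
    (\<forall>p. 2 \<le> p \<and> p + 3 \<le> n \<longrightarrow> time w p = time w (p + 2)) \<and>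
    (\<forall>i. middle w i \<and> control w i = Y \<longrightarrow> pi / 2 \<le> time w i \<and> time w i < pi) \<and>
    (n \<ge> 4 \<longrightarrow> (\<forall>i. middle w i \<and> control w i = X \<longrightarrow> time w i = pi / 2))"
    using w(2,3) glob_opt_n_optimal[OF w(1)] glob_opt_structure[OF w(1,2,4)] by blast
qed

end
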